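(* Let $(\mathcal{O},*,n)$ be an Okubo algebra over a field $\mathbb{F}$ of characteristic $\neq 3$. Then $(\mathcal{O},*,n)$ is split (i.e., isomorphic to the split Okubo algebra) if and only if $n$ is isotropic and $(\mathcal{O},*,n)$ contains an idempotent.
   Context: Idempotents are always nonzero. A Cayley algebra over $\mathbb{F}$ is an $8$-dimensional unital, not necessarily associative algebra $(\mathcal{C},\cdot)$ with a nonsingular quadratic form $n$ such that $n(x\cdot y)=n(x)n(y)$; polar form $n(x,y)=n(x+y)-n(x)-n(y)$ and conjugation $\bar x=n(x,1)1-x$. Given an automorphism $\tau$ with $\tau^3=\mathrm{id}$, the Petersson algebra $\mathcal{C}_\tau=(\mathcal{C},*,n)$ has product $x*y=\tau(\bar x)\cdot\tau^2(\bar y)$ and the same norm $n$. The split Cayley algebra has a canonical basis $e_1,e_2,u_1,u_2,u_3,v_1,v_2,v_3$ where $e_1,e_2$ are orthogonal idempotents with $e_1+e_2=1$, $e_1u_i=u_i=u_ie_2$, $e_2v_i=v_i=v_ie_1$, $e_2u_i=u_ie_1=e_1v_i=v_ie_2=0$, $u_iu_{i+1}=v_{i+2}=-u_{i+1}u_i$, $v_iv_{i+1}=u_{i+2}=-v_{i+1}v_i$ (indices modulo $3$), $u_i^2=v_i^2=0$, $u_iv_i=-e_1$, $v_iu_i=-e_2$, $u_iv_j=v_iu_j=0$ for $i\ne j$, and norm $n(\alpha e_1+\beta e_2+\sum_i\mu_iu_i+\sum_i\nu_iv_i)=\alpha\beta+\sum_i\mu_i\nu_i$. Its order $3$ automorphism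 $\tau_{st}$ fixes $e_1,e_2$ and maps $u_i\mapsto u_{i+1}$, $v_i\mapsto v_{i+1}$ (indices modulo $3$). The split Okubo algebra is the Petersson algebra $\mathcal{C}_{\tau_{st}}$ of the split Cayley algebra; an Okubo algebra $(\mathcal{O},*,n)$ is an algebra (with norm) that becomes isomorphic to the split Okubo algebra after an extension of scalars. *)

theory Defs
  imports "HOL-Analysis.Analysis"
begin

text \<open>A not necessarily associative or unital algebra with a norm; the underlying vector space
  is the whole type \<^typ>\<open>'v\<close>.\<close>

record ('f, 'v) normed_algebra =
  ascale :: "'f \<Rightarrow> 'v \<Rightarrow> 'v"
  amult :: "'v \<Rightarrow> 'v \<Rightarrow> 'v"
  anorm :: "'v \<Rightarrow> 'f"

definition polar :: "('v::ab_group_add \<Rightarrow> 'f::field) \<Rightarrow> 'v \<Rightarrow> 'v \<Rightarrow> 'f" where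
  "polar q x y = q (x + y) - q x - q y"

definition quadratic_form :: "('f::field \<Rightarrow> 'v::ab_group_add \<Rightarrow> 'v) \<Rightarrow> ('v \<Rightarrow> 'f) \<Rightarrow> bool" where
  "quadratic_form s q \<longleftrightarrow>
     (\<forall>c x. q (s c x) = c\<^sup>2 * q x) \<and> (\<forall>x. Vector_Spaces.linear s (*) (polar q x))"

definition is_normed_algebra :: "('f::field, 'v::ab_group_add) normed_algebra \<Rightarrow> bool" where
  "is_normed_algebra A \<longleftrightarrow>
     vector_space (ascale A) \<and>
     (\<forall>x. Vector_Spaces.linear (ascale A) (ascale A) (amult A x)) \<and>
     (\<forall>y. Vector_Spaces.linear (ascale A) (ascale A) (\<lambda>x. amult A x y)) \<and>
     quadratic_form (ascale A) (anorm A)"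

definition algebra_isomorphism ::
  "('f::field, 'v::ab_group_add) normed_algebra \<Rightarrow> ('f, 'w::ab_group_add) normed_algebra
    \<Rightarrow> ('v \<Rightarrow> 'w) \<Rightarrow> bool" where
  "algebra_isomorphism A B f \<longleftrightarrow>
     Vector_Spaces.linear (ascale A) (ascale B) f \<and> bij f \<and>
     (\<forall>x y. f (amult A x y) = amult B (f x) (f y)) \<and>
     (\<forall>x. anorm B (f x) = anorm A x)"

definition isomorphic_algebras ::
  "('f::field, 'v::ab_group_add) normed_algebra \<Rightarrow> ('f, 'w::ab_group_add) normed_algebra \<Rightarrow> bool"
  where "isomorphic_algebras A B \<longleftrightarrow> (\<exists>f. algebra_isomorphism A B f)"

definition is_idempotent :: "('f, 'v::zero) normed_algebra \<Rightarrow> 'v \<Rightarrow> bool" where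
  "is_idempotent A e \<longleftrightarrow> e \<noteq> 0 \<and> amult A e e = e"

definition isotropic :: "('v::zero \<Rightarrow> 'f::zero) \<Rightarrow> bool" where
  "isotropic q \<longleftrightarrow> (\<exists>x. x \<noteq> 0 \<and> q x = 0)"


subsection \<open>Extension of scalars\<close>

definition field_embedding :: "('f::field \<Rightarrow> 'k::field) \<Rightarrow> bool" where
  "field_embedding h \<longleftrightarrow>
     h 1 = 1 \<and> (\<forall>a b. h (a + b) = h a + h b) \<and> (\<forall>a b. h (a * b) = h a * h b)"

text \<open>\<open>W\<close> with \<open>\<iota>\<close> is the algebra \<open>K \<otimes> A\<close> with \<open>\<iota> x = 1 \<otimes> x\<close>, where \<open>K\<close> is an extension field via
  \<open>h\<close>: every basis of \<open>A\<close> becomes a \<open>K\<close>-basis of \<open>W\<close> with the same structure constants and the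
  same values of the norm (and hence of its polar form). This determines \<open>(W, \<iota>)\<close> up to a unique
  isomorphism, see \<open>scalar_extension_unique\<close>.\<close>

definition is_scalar_extension ::
  "('f::field \<Rightarrow> 'k::field) \<Rightarrow> ('f, 'v::ab_group_add) normed_algebra
    \<Rightarrow> ('k, 'w::ab_group_add) normed_algebra \<Rightarrow> ('v \<Rightarrow> 'w) \<Rightarrow> bool" where
  "is_scalar_extension h A W \<iota> \<longleftrightarrow>
     is_normed_algebra W \<and>
     (\<forall>x y. \<iota> (x + y) = \<iota> x + \<iota> y) \<and>
     (\<forall>c x. \<iota> (ascale A c x) = ascale W (h c) (\<iota> x)) \<and>
     (\<forall>B. \<not> module.dependent (ascale A) B \<and> module.span (ascale A) B = UNIV \<longrightarrow>
        inj_on \<iota> B \<and> \<not> module.dependent (ascale W) (\<iota> ` B) \<and>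
        module.span (ascale W) (\<iota> ` B) = UNIV) \<and>
     (\<forall>x y. \<iota> (amult A x y) = amult W (\<iota> x) (\<iota> y)) \<and>
     (\<forall>x. anorm W (\<iota> x) = h (anorm A x))"

lemma span_UNIV_induct:
  assumes "vector_space s" "module.span s B = UNIV"
    and "P 0" "\<And>c b y. b \<in> B \<Longrightarrow> P y \<Longrightarrow> P (s c b + y)"
  shows "P x"
proof -
  interpret vector_space s by fact
  show ?thesis
    by (rule span_induct_alt[of x B]) (use assms in auto)
qed

lemma quadratic_form_step:
  assumes "quadratic_form s q"
  shows "q (s c x + y) = c\<^sup>2 * q x + q y + c * polar q x y"
proof -
  have 1: "q (s c x) = c\<^sup>2 * q x" and 2: "Vector_Spaces.linear s (*) (polar q y)"
    using assms by (auto simp: quadratic_form_def)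
  interpret Vector_Spaces.linear s "(*)" "polar q y" by (rule 2)
  have "polar q y (s c x) = c * polar q y x" by (rule scale)
  then have "polar q (s c x) y = c * polar q x y" by (simp add: polar_def algebra_simps)
  then have "q (s c x + y) - q (s c x) - q y = c * polar q x y"
    by (simp only: polar_def[of q "s c x"])
  then show ?thesis by (simp add: 1 algebra_simps)
qed

lemma scalar_extension_hom:
  assumes A: "is_normed_algebra A"
    and W: "is_scalar_extension h A W \<iota>"
    and W': "is_scalar_extension h A W' \<iota>'"
  obtains f where "Vector_Spaces.linear (ascale W) (ascale W') f" "\<And>x. f (\<iota> x) = \<iota>' x"
    "\<And>x y. f (amult W x y) = amult W' (f x) (f y)" "\<And>x. anorm W' (f x) = anorm W x"
proof -
  interpret VA: vector_space "ascale A" using A by (simp add: is_normed_algebra_def)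
  have nW: "is_normed_algebra W" and nW': "is_normed_algebra W'"
    using W W' by (auto simp: is_scalar_extension_def)
  interpret VP: vector_space_pair "ascale W" "ascale W'"
    using nW nW' by (simp add: is_normed_algebra_def vector_space_pair_def)
  obtain B where B: "VA.independent B" "VA.span B = UNIV"
    using VA.basis_exists[of UNIV] by (metis top.extremum_uniqueI)
  have i: "inj_on \<iota> B" "VP.vs1.independent (\<iota> ` B)" and sp: "VP.vs1.span (\<iota> ` B) = UNIV"
    using W B by (auto simp: is_scalar_extension_def)
  define f where "f = VP.construct (\<iota> ` B) (\<iota>' \<circ> inv_into B \<iota>)"
  have lin: "Vector_Spaces.linear (ascale W) (ascale W') f"
    unfolding f_def by (rule VP.linear_construct[OF i(2)])
  interpret f: Vector_Spaces.linear "ascale W" "ascale W'" f by (rule lin)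
  have fB: "f (\<iota> b) = \<iota>' b" if "b \<in> B" for b
    using that i by (simp add: f_def VP.construct_basis)
  have z: "\<iota> 0 = 0" "\<iota>' 0 = 0" using W W' unfolding is_scalar_extension_def
    by (metis add_cancel_right_right)+
  have f\<iota>: "f (\<iota> x) = \<iota>' x" for x
    by (rule span_UNIV_induct[OF VA.vector_space_axioms B(2)])
      (use W W' in \<open>auto simp: z f.zero f.add f.scale fB is_scalar_extension_def\<close>)
  have mW: "amult W (\<iota> x) (\<iota> y) = \<iota> (amult A x y)"
    "amult W' (\<iota>' x) (\<iota>' y) = \<iota>' (amult A x y)" for x y
    using W W' by (auto simp: is_scalar_extension_def)
  have lm: "Vector_Spaces.linear (ascale W) (ascale W) (amult W x)"
    "Vector_Spaces.linear (ascale W) (ascale W) (\<lambda>x. amult W x y)" for x y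
    using nW by (auto simp: is_normed_algebra_def)
  have lm': "Vector_Spaces.linear (ascale W') (ascale W') (amult W' x)"
    "Vector_Spaces.linear (ascale W') (ascale W') (\<lambda>x. amult W' x y)" for x y
    using nW' by (auto simp: is_normed_algebra_def)
  have q: "quadratic_form (ascale W) (anorm W)" "quadratic_form (ascale W') (anorm W')"
    using nW nW' by (auto simp: is_normed_algebra_def)
  have L0: "Vector_Spaces.linear s t g \<Longrightarrow> g 0 = 0"
    and LS: "Vector_Spaces.linear s t g \<Longrightarrow> g (s c u + v) = t c (g u) + g v" for s t g c u v
    by (auto simp: Vector_Spaces.linear_def module_hom.add module_hom.scale module_hom.zero)
  have m1: "f (amult W (\<iota> a) y) = amult W' (\<iota>' a) (f y)" for a y
    by (rule span_UNIV_induct[OF VP.vs1.vector_space_axioms sp])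
      (auto simp: L0[OF lm(1)] LS[OF lm(1)] L0[OF lm'(1)] LS[OF lm'(1)] L0[OF lin] LS[OF lin] mW f\<iota>)
  have m: "f (amult W x y) = amult W' (f x) (f y)" for x y
    by (rule span_UNIV_induct[OF VP.vs1.vector_space_axioms sp, where P = "\<lambda>x. f (amult W x y) = amult W' (f x) (f y)"])
      (auto simp: L0[OF lm(2)] LS[OF lm(2)] L0[OF lm'(2)] LS[OF lm'(2)] L0[OF lin] LS[OF lin] m1 f\<iota>)
  have pl: "Vector_Spaces.linear (ascale W) (*) (polar (anorm W) x)"
    "Vector_Spaces.linear (ascale W') (*) (polar (anorm W') x')" for x x'
    using q by (auto simp: quadratic_form_def)
  have n\<iota>: "anorm W (\<iota> x) = h (anorm A x)" "anorm W' (\<iota>' x) = h (anorm A x)" for x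
    using W W' by (auto simp: is_scalar_extension_def)
  have p0: "polar (anorm W) (\<iota> a) (\<iota> b) = polar (anorm W') (\<iota>' a) (\<iota>' b)" for a b
  proof -
    have "\<iota> a + \<iota> b = \<iota> (a + b)" "\<iota>' a + \<iota>' b = \<iota>' (a + b)"
      using W W' by (auto simp: is_scalar_extension_def)
    then show ?thesis by (simp add: polar_def n\<iota>)
  qed
  have p: "polar (anorm W) (\<iota> a) y = polar (anorm W') (\<iota>' a) (f y)" for a y
    by (rule span_UNIV_induct[OF VP.vs1.vector_space_axioms sp])
      (auto simp: L0[OF pl(1)] LS[OF pl(1)] L0[OF pl(2)] LS[OF pl(2)] L0[OF lin] LS[OF lin] p0 f\<iota>)
  have n0: "anorm W 0 = 0" "anorm W' 0 = 0"
    using q VP.vs1.scale_zero_left VP.vs2.scale_zero_left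
    unfolding quadratic_form_def by (metis mult_zero_left zero_power2)+
  have n: "anorm W' (f x) = anorm W x" for x
    by (rule span_UNIV_induct[OF VP.vs1.vector_space_axioms sp])
      (auto simp: L0[OF lin] LS[OF lin] n0 quadratic_form_step[OF q(1)] quadratic_form_step[OF q(2)] f\<iota> p n\<iota>)
  show ?thesis by (rule that[OF lin f\<iota> m n])
qed

lemma scalar_extension_linear_unique:
  assumes A: "is_normed_algebra A"
    and W: "is_scalar_extension h A W \<iota>"
    and f: "Vector_Spaces.linear (ascale W) s f" and g: "Vector_Spaces.linear (ascale W) s g"
    and eq: "\<And>x. f (\<iota> x) = g (\<iota> x)"
  shows "f = g"
proof
  fix x
  interpret VA: vector_space "ascale A" using A by (simp add: is_normed_algebra_def)
  interpret f: Vector_Spaces.linear "ascale W" s f by (rule f)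
  interpret g: Vector_Spaces.linear "ascale W" s g by (rule g)
  obtain B where B: "VA.independent B" "VA.span B = UNIV"
    using VA.basis_exists[of UNIV] by (metis top.extremum_uniqueI)
  then have sp: "f.vs1.span (\<iota> ` B) = UNIV"
    using W by (auto simp: is_scalar_extension_def)
  show "f x = g x"
    by (rule span_UNIV_induct[OF f.vs1.vector_space_axioms sp])
      (auto simp: f.zero g.zero f.add g.add f.scale g.scale eq)
qed

lemma scalar_extension_unique:
  assumes "is_normed_algebra A" "is_scalar_extension h A W \<iota>" "is_scalar_extension h A W' \<iota>'"
  shows "\<exists>!f. algebra_isomorphism W W' f \<and> f \<circ> \<iota> = \<iota>'"
proof -
  obtain f where f: "Vector_Spaces.linear (ascale W) (ascale W') f" "\<And>x. f (\<iota> x) = \<iota>' x"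
    "\<And>x y. f (amult W x y) = amult W' (f x) (f y)" "\<And>x. anorm W' (f x) = anorm W x"
    using scalar_extension_hom[OF assms] by metis
  obtain g where g: "Vector_Spaces.linear (ascale W') (ascale W) g" "\<And>x. g (\<iota>' x) = \<iota> x"
    using scalar_extension_hom[OF assms(1,3,2)] by metis
  interpret f: Vector_Spaces.linear "ascale W" "ascale W'" f by (rule f)
  have gf: "g \<circ> f = id" and fg: "f \<circ> g = id"
    by (rule scalar_extension_linear_unique[OF assms(1,2)
          Vector_Spaces.linear_compose[OF f(1) g(1)] f.vs1.linear_id], simp add: f g)
       (rule scalar_extension_linear_unique[OF assms(1,3)
          Vector_Spaces.linear_compose[OF g(1) f(1)] f.vs2.linear_id], simp add: f g)
  then have "bij f" by (rule o_bij)
  then have "algebra_isomorphism W W' f \<and> f \<circ> \<iota> = \<iota>'"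
    using f by (auto simp: algebra_isomorphism_def)
  moreover have "f' = f" if "algebra_isomorphism W W' f' \<and> f' \<circ> \<iota> = \<iota>'" for f'
    by (rule scalar_extension_linear_unique[OF assms(1,2) _ f(1)])
      (use that f(2) in \<open>auto simp: algebra_isomorphism_def\<close>)
  ultimately show ?thesis by blast
qed


subsection \<open>The split Cayley algebra\<close>

text \<open>Indices of the canonical basis. The numeral type \<^typ>\<open>3\<close> carries arithmetic modulo 3.\<close>

datatype cayley_index = Ie1 | Ie2 | Iu 3 | Iv 3

lemma UNIV_cayley_index: "(UNIV :: cayley_index set) = {Ie1, Ie2} \<union> range Iu \<union> range Iv"
proof -
  have "x \<in> {Ie1, Ie2} \<union> range Iu \<union> range Iv" for x by (cases x) auto
  then show ?thesis by blast
qed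

instance cayley_index :: finite
  by standard (simp add: UNIV_cayley_index)

abbreviation cayley_basis :: "cayley_index \<Rightarrow> 'f::field ^ cayley_index" where
  "cayley_basis i \<equiv> axis i 1"

fun cayley_table :: "cayley_index \<Rightarrow> cayley_index \<Rightarrow> 'f::field ^ cayley_index" where
  "cayley_table Ie1 Ie1 = cayley_basis Ie1"
| "cayley_table Ie2 Ie2 = cayley_basis Ie2"
| "cayley_table Ie1 Ie2 = 0"
| "cayley_table Ie2 Ie1 = 0"
| "cayley_table Ie1 (Iu i) = cayley_basis (Iu i)"
| "cayley_table (Iu i) Ie2 = cayley_basis (Iu i)"
| "cayley_table Ie2 (Iv i) = cayley_basis (Iv i)"
| "cayley_table (Iv i) Ie1 = cayley_basis (Iv i)"
| "cayley_table Ie2 (Iu i) = 0"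
| "cayley_table (Iu i) Ie1 = 0"
| "cayley_table Ie1 (Iv i) = 0"
| "cayley_table (Iv i) Ie2 = 0"
| "cayley_table (Iu i) (Iu j) =
     (if j = i + 1 then cayley_basis (Iv (i + 2)) else if i = j + 1 then - cayley_basis (Iv (j + 2)) else 0)"
| "cayley_table (Iv i) (Iv j) =
     (if j = i + 1 then cayley_basis (Iu (i + 2)) else if i = j + 1 then - cayley_basis (Iu (j + 2)) else 0)"
| "cayley_table (Iu i) (Iv j) = (if i = j then - cayley_basis Ie1 else 0)"
| "cayley_table (Iv i) (Iu j) = (if i = j then - cayley_basis Ie2 else 0)"

definition split_cayley :: "('f::field, 'f ^ cayley_index) normed_algebra" where
  "split_cayley = \<lparr>
     ascale = (*s),
     amult = (\<lambda>x y. \<Sum>i\<in>UNIV. \<Sum>j\<in>UNIV. (x $ i * y $ j) *s cayley_table i j),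
     anorm = (\<lambda>x. x $ Ie1 * x $ Ie2 + (\<Sum>i\<in>UNIV. x $ Iu i * x $ Iv i)) \<rparr>"

definition cayley_one :: "'f::field ^ cayley_index" where
  "cayley_one = cayley_basis Ie1 + cayley_basis Ie2"

primrec shift_index :: "cayley_index \<Rightarrow> cayley_index" where
  "shift_index Ie1 = Ie1"
| "shift_index Ie2 = Ie2"
| "shift_index (Iu i) = Iu (i + 1)"
| "shift_index (Iv i) = Iv (i + 1)"

definition tau_st :: "'f::field ^ cayley_index \<Rightarrow> 'f ^ cayley_index" where
  "tau_st x = (\<Sum>i\<in>UNIV. x $ i *s cayley_basis (shift_index i))"


subsection \<open>Petersson algebras and Okubo algebras\<close>

definition conjugation ::
  "('f::field, 'v::ab_group_add) normed_algebra \<Rightarrow> 'v \<Rightarrow> 'v \<Rightarrow> 'v" where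
  "conjugation C u x = ascale C (polar (anorm C) x u) u - x"

text \<open>\<open>u\<close> is the unit element of \<open>C\<close>.\<close>

definition petersson ::
  "('f::field, 'v::ab_group_add) normed_algebra \<Rightarrow> 'v \<Rightarrow> ('v \<Rightarrow> 'v) \<Rightarrow> ('f, 'v) normed_algebra"
  where
  "petersson C u \<tau> = \<lparr>
     ascale = ascale C,
     amult = (\<lambda>x y. amult C (\<tau> (conjugation C u x)) (\<tau> (\<tau> (conjugation C u y)))),
     anorm = anorm C \<rparr>"

definition split_okubo :: "('f::field, 'f ^ cayley_index) normed_algebra" where
  "split_okubo = petersson split_cayley cayley_one tau_st"

text \<open>The extension field and the space underlying the extended algebra are existentially quantified
  in the notion of an Okubo algebra. HOL has no quantification over types, so their types are
  parameters; in a hypothesis, a free type variable in their place expresses the existential.\<close>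

definition okubo_algebra ::
  "'k::field itself \<Rightarrow> 'w::ab_group_add itself \<Rightarrow> ('f::field, 'v::ab_group_add) normed_algebra \<Rightarrow> bool"
  where
  "okubo_algebra _ _ A \<longleftrightarrow>
     is_normed_algebra A \<and>
     (\<exists>(h :: 'f \<Rightarrow> 'k) (W :: ('k, 'w) normed_algebra) \<iota>.
        field_embedding h \<and> is_scalar_extension h A W \<iota> \<and> isomorphic_algebras W split_okubo)"


subsection \<open>Basic properties of the split algebras\<close>

lemma sum_cayley_index:
  "sum f (UNIV :: cayley_index set) = f Ie1 + f Ie2 + (\<Sum>i\<in>UNIV. f (Iu i)) + (\<Sum>i\<in>UNIV. f (Iv i))"
proof -
  have "sum f (UNIV :: cayley_index set) = sum f ({Ie1, Ie2} \<union> range Iu \<union> range Iv)"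
    by (simp add: UNIV_cayley_index)
  also have "\<dots> = f Ie1 + f Ie2 + sum f (range Iu) + sum f (range Iv)"
    by (subst sum.union_disjoint; (subst sum.union_disjoint)?; auto simp: add.assoc)
  also have "sum f (range Iu) = (\<Sum>i\<in>UNIV. f (Iu i))" by (subst sum.reindex) (auto simp: inj_def)
  also have "sum f (range Iv) = (\<Sum>i\<in>UNIV. f (Iv i))" by (subst sum.reindex) (auto simp: inj_def)
  finally show ?thesis .
qed

lemma cayley_vec_eq_iff:
  "(x :: 'f ^ cayley_index) = y \<longleftrightarrow>
     x $ Ie1 = y $ Ie1 \<and> x $ Ie2 = y $ Ie2 \<and> (\<forall>i. x $ Iu i = y $ Iu i) \<and> (\<forall>i. x $ Iv i = y $ Iv i)"
  by (metis cayley_index.exhaust vec_eq_iff)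

lemma three_simps: "(4::3) = 1" "(5::3) = 2" "(6::3) = 3" "(7::3) = 1"
  by simp_all

lemma cayley_mult_nth:
  fixes x y :: "'f::field ^ cayley_index"
  shows "amult split_cayley x y $ Ie1 = x $ Ie1 * y $ Ie1 - (\<Sum>i\<in>UNIV. x $ Iu i * y $ Iv i)"
    "amult split_cayley x y $ Ie2 = x $ Ie2 * y $ Ie2 - (\<Sum>i\<in>UNIV. x $ Iv i * y $ Iu i)"
    "amult split_cayley x y $ Iu i = x $ Ie1 * y $ Iu i + x $ Iu i * y $ Ie2
       + x $ Iv (i + 1) * y $ Iv (i + 2) - x $ Iv (i + 2) * y $ Iv (i + 1)"
    "amult split_cayley x y $ Iv i = x $ Ie2 * y $ Iv i + x $ Iv i * y $ Ie1
       + x $ Iu (i + 1) * y $ Iu (i + 2) - x $ Iu (i + 2) * y $ Iu (i + 1)"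
proof -
  show "amult split_cayley x y $ Ie1 = x $ Ie1 * y $ Ie1 - (\<Sum>i\<in>UNIV. x $ Iu i * y $ Iv i)"
    "amult split_cayley x y $ Ie2 = x $ Ie2 * y $ Ie2 - (\<Sum>i\<in>UNIV. x $ Iv i * y $ Iu i)"
    by (simp_all add: split_cayley_def sum_cayley_index sum_3 axis_def)
  have "\<forall>i. amult split_cayley x y $ Iu i = x $ Ie1 * y $ Iu i + x $ Iu i * y $ Ie2
       + x $ Iv (i + 1) * y $ Iv (i + 2) - x $ Iv (i + 2) * y $ Iv (i + 1)"
    "\<forall>i. amult split_cayley x y $ Iv i = x $ Ie2 * y $ Iv i + x $ Iv i * y $ Ie1
       + x $ Iu (i + 1) * y $ Iu (i + 2) - x $ Iu (i + 2) * y $ Iu (i + 1)"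
    unfolding forall_3
    by (simp_all add: split_cayley_def sum_cayley_index sum_3 axis_def three_simps)
  then show "amult split_cayley x y $ Iu i = x $ Ie1 * y $ Iu i + x $ Iu i * y $ Ie2
       + x $ Iv (i + 1) * y $ Iv (i + 2) - x $ Iv (i + 2) * y $ Iv (i + 1)"
    "amult split_cayley x y $ Iv i = x $ Ie2 * y $ Iv i + x $ Iv i * y $ Ie1
       + x $ Iu (i + 1) * y $ Iu (i + 2) - x $ Iu (i + 2) * y $ Iu (i + 1)"
    by blast+
qed

lemma anorm_cayley: "anorm split_cayley z = z $ Ie1 * z $ Ie2 + (\<Sum>i\<in>UNIV. z $ Iu i * z $ Iv i)"
    by (simp add: split_cayley_def)

lemma cayley_one_nth: "cayley_one $ Ie1 = 1" "cayley_one $ Ie2 = 1" "cayley_one $ Iu i = 0" "cayley_one $ Iv i = 0"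
  by (simp_all add: cayley_one_def axis_def)

lemma cayley_unit: "amult split_cayley cayley_one x = x" "amult split_cayley x cayley_one = x"
  by (simp_all add: cayley_vec_eq_iff cayley_mult_nth cayley_one_nth)

lemma tau_st_nth: "tau_st x $ Ie1 = x $ Ie1" "tau_st x $ Ie2 = x $ Ie2"
  "tau_st x $ Iu i = x $ Iu (i + 2)" "tau_st x $ Iv i = x $ Iv (i + 2)"
proof -
  have "\<forall>i. tau_st x $ Iu i = x $ Iu (i + 2)" "\<forall>i. tau_st x $ Iv i = x $ Iv (i + 2)"
    unfolding forall_3
    by (simp_all add: tau_st_def sum_cayley_index sum_3 axis_def three_simps)
  then show "tau_st x $ Iu i = x $ Iu (i + 2)" "tau_st x $ Iv i = x $ Iv (i + 2)" by blast+
qed (simp_all add: tau_st_def sum_cayley_index sum_3 axis_def)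

lemma tau_st_mult: "tau_st (amult split_cayley x y) = amult split_cayley (tau_st x) (tau_st y)"
  unfolding cayley_vec_eq_iff forall_3
  by (simp add: cayley_mult_nth tau_st_nth sum_3 three_simps)

lemma tau_st_cube: "tau_st (tau_st (tau_st x)) = x"
  unfolding cayley_vec_eq_iff forall_3
  by (simp add: tau_st_nth three_simps)

lemma split_okubo_sel: "ascale split_okubo = (*s)" "anorm split_okubo = anorm split_cayley"
  by (simp_all add: split_okubo_def petersson_def split_cayley_def)

lemma conjugation_nth: "conjugation split_cayley cayley_one x $ Ie1 = x $ Ie2" "conjugation split_cayley cayley_one x $ Ie2 = x $ Ie1"
 "conjugation split_cayley cayley_one x $ Iu i = - x $ Iu i" "conjugation split_cayley cayley_one x $ Iv i = - x $ Iv i"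
  by (simp_all add: conjugation_def split_cayley_def polar_def cayley_one_nth sum_3 algebra_simps)

lemma split_okubo_mult: "amult split_okubo x y = amult split_cayley (tau_st (conjugation split_cayley cayley_one x)) (tau_st (tau_st (conjugation split_cayley cayley_one y)))"
  by (simp add: split_okubo_def petersson_def)

lemma cart_linearI: "(\<And>x y. f (x+y) = f x + f y) \<Longrightarrow> (\<And>c x. f (c *s x) = s c (f x)) \<Longrightarrow> vector_space s \<Longrightarrow> Vector_Spaces.linear (*s) s f"
  by (simp add: Vector_Spaces.linear_iff vec.vector_space_axioms)

lemma tau_st_conjugation_linear:
  "tau_st (x + y) = tau_st x + tau_st y" "tau_st (c *s x) = c *s tau_st x"
  "conjugation split_cayley cayley_one (x + y) = conjugation split_cayley cayley_one x + conjugation split_cayley cayley_one y"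
  "conjugation split_cayley cayley_one (c *s x) = c *s conjugation split_cayley cayley_one x"
  by (simp_all add: cayley_vec_eq_iff tau_st_nth conjugation_nth)

lemma split_cayley_bilinear:
  "amult split_cayley (x + y) z = amult split_cayley x z + amult split_cayley y z"
  "amult split_cayley z (x + y) = amult split_cayley z x + amult split_cayley z y"
  "amult split_cayley (c *s x) z = c *s amult split_cayley x z"
  "amult split_cayley z (c *s x) = c *s amult split_cayley z x"
  by (simp_all add: split_cayley_def sum.distrib ring_distribs vec.scale_left_distrib vec.scale_sum_right mult.assoc mult.left_commute)

lemma split_okubo_is_normed_algebra: "is_normed_algebra (split_okubo :: ('f::field, 'f ^ cayley_index) normed_algebra)"
  unfolding is_normed_algebra_def split_okubo_sel quadratic_form_def split_okubo_mult
  apply (intro conjI allI cart_linearI vec.vector_space_axioms vector_space_over_itself.vector_space_axioms)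
  apply (simp_all only: tau_st_conjugation_linear split_cayley_bilinear)
  apply (simp_all add: anorm_cayley polar_def sum_3 ring_distribs power2_eq_square)
  done

lemma split_okubo_scalar_extension:
  assumes h: "field_embedding h"
  shows "is_scalar_extension h split_okubo split_okubo (\<lambda>x. \<chi> i. h (x $ i))"
proof -
  let ?i = "\<lambda>x :: 'a ^ cayley_index. (\<chi> i. h (x $ i)) :: 'b ^ cayley_index"
  have a: "h (x + y) = h x + h y" "h (x * y) = h x * h y" "h 1 = 1" for x y using h by (auto simp: field_embedding_def)
  have z: "h 0 = 0" using a(1)[of 0 0] by (metis add_cancel_right_right add_0)
  have m: "h (- x) = - h x" for x using a(1)[of "-x" x] z by (simp add: eq_neg_iff_add_eq_0)
  have d: "h (x - y) = h x - h y" for x y using a(1)[of x "-y"] m by simp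
  have ax: "?i (axis j 1) = axis j 1" for j by (simp add: vec_eq_iff axis_def a z)
  have sp: "vec.span (?i ` B) = UNIV" if "vec.span B = UNIV" for B
  proof -
    have ad: "?i (c *s b + y) = h c *s ?i b + ?i y" for c b y by (simp add: vec_eq_iff a)
    have z0: "?i 0 = 0" by (simp add: vec_eq_iff z)
    have "?i x \<in> vec.span (?i ` B)" for x
      apply (rule span_UNIV_induct[OF vec.vector_space_axioms that])
       apply (simp only: z0 vec.span_zero)
      apply (simp only: ad)
      apply (intro vec.span_add vec.span_scale)
       apply (rule vec.span_base, simp)
      by assumption
    then have "cart_basis \<subseteq> vec.span (?i ` B)" unfolding cart_basis_def using ax by (auto) (metis ax)
    then have "vec.span cart_basis \<subseteq> vec.span (?i ` B)" by (rule vec.span_minimal) (rule vec.subspace_span)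
    then show ?thesis by (simp add: vec.span_Basis top.extremum_unique)
  qed
  have ind: "inj_on ?i B \<and> vec.independent (?i ` B)" if "vec.independent B" "vec.span B = UNIV" for B
  proof -
    have fB: "finite B" using that(1) vec.finiteI_independent by blast
    have cc: "card (cart_basis :: ('a ^ cayley_index) set) = card (cart_basis :: ('b ^ cayley_index) set)" by (simp add: card_cart_basis)
    have cB: "card B = card (cart_basis :: ('a ^ cayley_index) set)" using vec.dim_eq_card[OF _ that(1), of UNIV] that by simp
    have "card (cart_basis :: ('b ^ cayley_index) set) \<le> card (?i ` B)"
      using vec.dim_le_card[of UNIV "?i ` B"] sp[OF that(2)] fB by simp
    then have c: "card (?i ` B) = card B" using card_image_le[OF fB, of ?i] cB cc by simp
    then have "inj_on ?i B" using fB eq_card_imp_inj_on by blast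
    moreover have "vec.independent (?i ` B)"
      by (rule vec.card_le_dim_spanning[of _ UNIV]) (use sp that fB c cB cc in \<open>auto\<close>)
    ultimately show ?thesis by blast
  qed
  show ?thesis unfolding is_scalar_extension_def
  proof (intro conjI allI impI)
    show "is_normed_algebra (split_okubo :: ('b, 'b ^ cayley_index) normed_algebra)" by (rule split_okubo_is_normed_algebra)
  next
    fix x y show "?i (amult split_okubo x y) = amult split_okubo (?i x) (?i y)"
      by (simp add: cayley_vec_eq_iff forall_3 split_okubo_mult cayley_mult_nth tau_st_nth conjugation_nth sum_3 three_simps a m d)
  next
    fix x show "anorm split_okubo (?i x) = h (anorm split_okubo x)" by (simp add: split_okubo_sel anorm_cayley sum_3 a)
  qed (use sp ind in \<open>auto simp: split_okubo_sel a vec_eq_iff\<close>)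
qed

lemma isomorphic_algebras_refl: "is_normed_algebra A \<Longrightarrow> isomorphic_algebras A A"
  unfolding isomorphic_algebras_def algebra_isomorphism_def is_normed_algebra_def
  using vector_space.linear_id by (intro exI[of _ id]) auto

lemma split_okubo_is_okubo_algebra:
  "field_embedding (h :: 'f::field \<Rightarrow> 'k::field) \<Longrightarrow> okubo_algebra TYPE('k) TYPE('k ^ cayley_index) (split_okubo :: ('f, 'f ^ cayley_index) normed_algebra)"
  unfolding okubo_algebra_def by (intro conjI exI split_okubo_is_normed_algebra, assumption, rule split_okubo_scalar_extension, assumption, intro isomorphic_algebras_refl split_okubo_is_normed_algebra)

lemma split_okubo_isotropic_idempotent:
  "isotropic (anorm split_okubo)" "is_idempotent split_okubo cayley_one"
proof -
  have "cayley_basis Ie1 \<noteq> 0 \<and> anorm split_okubo (cayley_basis Ie1) = 0" by (simp add: split_okubo_sel anorm_cayley axis_def vec_eq_iff)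
  then show "isotropic (anorm split_okubo)" unfolding isotropic_def by blast
  show "is_idempotent split_okubo cayley_one"
   by (simp add: is_idempotent_def cayley_vec_eq_iff split_okubo_mult cayley_mult_nth cayley_one_nth tau_st_nth conjugation_nth)
qed

end

theory Submission
  imports Defs
begin

text \<open>
  An idempotent \<open>e\<close> makes the Okubo algebra a Petersson algebra with automorphism
  \<open>\<tau> x = e * (e * x)\<close> of order 3, and the algebra is the orthogonal sum of \<open>Q = ker (\<tau> - 1)\<close> and
  \<open>N = ker (1 + \<tau> + \<tau>\<^sup>2)\<close>. Besides the identities of a symmetric composition algebra, every Okubo
  algebra satisfies the identity "cyclic sum of \<open>(x * y) * z\<close> = cyclic sum of \<open>x * (y * z)\<close>", which
  is half of the Jacobi identity for the commutator. In characteristic different from 3 it forces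
  \<open>N * N \<subseteq> Q\<close>.

  Consequently there is \<open>x\<close> with \<open>n x = 0\<close> and \<open>n (x, x * x) = 1\<close>: if \<open>Q\<close> is isotropic, \<open>x\<close> is an
  isotropic element of trace 1 in \<open>Q\<close>, and otherwise \<open>N\<close> contains \<open>w\<close> of norm -1 and
  \<open>x = - (e + w)\<close>. Such an \<open>x\<close> plays the role of \<open>e\<^sub>1\<close>, with \<open>e\<^sub>2 = x * x\<close> and the new idempotent
  \<open>e\<^sub>1 + e\<^sub>2\<close> as unit. In the Peirce space \<open>U\<close> of \<open>e\<^sub>1\<close>, an element \<open>u\<close> with \<open>n (u, u * u) = 1\<close>
  (found as the sum of a \<open>\<tau>\<close>-fixed element and an element of \<open>N\<close>) generates the canonical basis
  \<open>u\<^sub>i = \<tau>\<^bsup>i-1\<^esup> u\<close>, \<open>v\<^sub>i = u\<^sub>i * u\<^sub>i\<close>, and the whole multiplication table follows.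
\<close>

subsection \<open>Symmetric composition algebras\<close>

locale symmetric_composition =
  fixes A :: "('f::field, 'v::ab_group_add) normed_algebra"
  assumes normed: "is_normed_algebra A"
    and norm_mult: "anorm A (amult A x y) = anorm A x * anorm A y"
    and polar_assoc: "polar (anorm A) (amult A x y) z = polar (anorm A) x (amult A y z)"
    and flexible_left: "amult A (amult A x y) x = ascale A (anorm A x) y"
    and flexible_right: "amult A x (amult A y x) = ascale A (anorm A x) y"
begin

abbreviation scl (infixr "\<cdot>" 75) where "scl \<equiv> ascale A"
abbreviation mul (infixl "\<star>" 70) where "mul \<equiv> amult A"
abbreviation n where "n \<equiv> anorm A"
abbreviation b where "b \<equiv> polar n"

sublocale vector_space scl
  using normed by (simp add: is_normed_algebra_def)

lemma mul_linear: "Vector_Spaces.linear scl scl (mul x)" "Vector_Spaces.linear scl scl (\<lambda>x. mul x y)"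
  and polar_linear: "Vector_Spaces.linear scl (*) (b x)"
  and norm_scale: "n (c \<cdot> x) = c\<^sup>2 * n x"
  using normed by (simp_all add: is_normed_algebra_def quadratic_form_def)

lemma polar_sym: "b x y = b y x"
  by (simp add: polar_def algebra_simps)

lemma bilinear_simps:
  "x \<star> (y + z) = x \<star> y + x \<star> z" "(y + z) \<star> x = y \<star> x + z \<star> x"
  "x \<star> (y - z) = x \<star> y - x \<star> z" "(y - z) \<star> x = y \<star> x - z \<star> x"
  "x \<star> (- y) = - (x \<star> y)" "(- y) \<star> x = - (y \<star> x)" "x \<star> 0 = 0" "0 \<star> x = 0"
  "x \<star> (c \<cdot> y) = c \<cdot> (x \<star> y)" "(c \<cdot> y) \<star> x = c \<cdot> (y \<star> x)"
proof -
  interpret l: Vector_Spaces.linear scl scl "mul x" by (rule mul_linear)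
  interpret r: Vector_Spaces.linear scl scl "\<lambda>y. mul y x" by (rule mul_linear)
  show "x \<star> (y + z) = x \<star> y + x \<star> z" "(y + z) \<star> x = y \<star> x + z \<star> x"
    "x \<star> (y - z) = x \<star> y - x \<star> z" "(y - z) \<star> x = y \<star> x - z \<star> x"
    "x \<star> (- y) = - (x \<star> y)" "(- y) \<star> x = - (y \<star> x)" "x \<star> 0 = 0" "0 \<star> x = 0"
    "x \<star> (c \<cdot> y) = c \<cdot> (x \<star> y)" "(c \<cdot> y) \<star> x = c \<cdot> (y \<star> x)"
    by (rule l.add r.add l.diff r.diff l.neg r.neg l.zero r.zero l.scale r.scale)+
qed

lemma polar_simps:
  "b x (y + z) = b x y + b x z" "b (y + z) x = b y x + b z x"
  "b x (y - z) = b x y - b x z" "b (y - z) x = b y x - b z x"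
  "b x (- y) = - b x y" "b (- y) x = - b y x" "b x 0 = 0" "b 0 x = 0"
  "b x (c \<cdot> y) = c * b x y" "b (c \<cdot> y) x = c * b y x"
proof -
  interpret l: Vector_Spaces.linear scl "(*)" "b x" by (rule polar_linear)
  show "b x (y + z) = b x y + b x z" "b (y + z) x = b y x + b z x"
    "b x (y - z) = b x y - b x z" "b (y - z) x = b y x - b z x"
    "b x (- y) = - b x y" "b (- y) x = - b y x" "b x 0 = 0" "b 0 x = 0"
    "b x (c \<cdot> y) = c * b x y" "b (c \<cdot> y) x = c * b y x"
    by (simp_all add: polar_sym[of _ x] l.add l.diff l.neg l.zero l.scale)
qed

lemma norm_add: "n (x + y) = n x + n y + b x y"
  by (simp add: polar_def)

lemma norm_minus: "n (- x) = n x"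
  using norm_scale[of "-1" x] by simp

lemma polar_self: "b x x = 2 * n x"
proof -
  have "n (x + x) = n (2 \<cdot> x)" using scale_left_distrib[of 1 1 x] by simp
  then show ?thesis by (simp add: norm_scale polar_def power2_eq_square)
qed

lemma flexible_left_polar: "(x \<star> y) \<star> z + (z \<star> y) \<star> x = b x z \<cdot> y"
  using flexible_left[of "x + z" y] flexible_left[of x y] flexible_left[of z y]
  by (simp add: norm_add bilinear_simps scale_left_distrib algebra_simps)

lemma flexible_right_polar: "x \<star> (y \<star> z) + z \<star> (y \<star> x) = b x z \<cdot> y"
  using flexible_right[of "x + z" y] flexible_right[of x y] flexible_right[of z y]
  by (simp add: norm_add bilinear_simps scale_left_distrib algebra_simps)

lemma polar_rotate: "b (x \<star> y) z = b (y \<star> z) x"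
  by (metis polar_assoc polar_sym)

text \<open>Linearised flexibility at \<open>z = x \<star> x\<close>. For isotropic \<open>x\<close>
  with \<open>b x (x \<star> x) = 1\<close> it says that \<open>x\<close> is the square of its own
  square.\<close>

lemma square_of_square: "(x \<star> x) \<star> (x \<star> x) = b x (x \<star> x) \<cdot> x - n x \<cdot> (x \<star> x)"
  using flexible_left_polar[of x x "x \<star> x"] by (simp add: flexible_left bilinear_simps algebra_simps)

end

subsection \<open>The automorphism of order 3 attached to an idempotent\<close>

locale idempotent_composition = symmetric_composition A
  for A :: "('f::field, 'v::ab_group_add) normed_algebra" +
  fixes e :: 'v
  assumes idem: "amult A e e = e" and e_nonzero: "e \<noteq> 0"
begin

definition \<tau> where "\<tau> x = e \<star> (e \<star> x)"

lemma norm_e: "n e = 1"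
  using flexible_left[of e e] idem e_nonzero
  by (metis scale_cancel_right scale_one)

lemma polar_e: "b e e = 2" "b e (e \<star> x) = b e x" "b e (x \<star> e) = b e x"
  by (simp_all add: polar_self norm_e, (metis idem polar_assoc polar_sym)+)

lemma e_left_right: "(e \<star> x) \<star> e = x" "e \<star> (x \<star> e) = x"
  by (simp_all add: flexible_left flexible_right norm_e)

text \<open>The vector \<open>b e x \<cdot> e - x\<close> is the conjugate of \<open>x\<close> with
  respect to \<open>e\<close>, so \<tau> is conjugation followed by right multiplication by
  \<open>e\<close>.\<close>

lemma tau_eq: "\<tau> x = b e x \<cdot> e - x \<star> e"
  using flexible_right_polar[of e e x] by (simp add: \<tau>_def idem eq_diff_eq)

lemma tau_linear: "\<tau> (x + y) = \<tau> x + \<tau> y" "\<tau> (x - y) = \<tau> x - \<tau> y" "\<tau> (- x) = - \<tau> x"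
    "\<tau> (c \<cdot> x) = c \<cdot> \<tau> x" "\<tau> 0 = 0"
  by (simp_all add: \<tau>_def bilinear_simps)

lemma tau_e: "\<tau> e = e" by (simp add: \<tau>_def idem)

lemma tau_polar_e: "b e (\<tau> x) = b e x"
  by (simp add: \<tau>_def polar_e)

lemma tau2_eq: "\<tau> (\<tau> x) = b e x \<cdot> e - e \<star> x"
  using tau_eq[of "\<tau> x"] by (simp add: tau_polar_e) (simp add: \<tau>_def e_left_right)

lemma tau_cube: "\<tau> (\<tau> (\<tau> x)) = x"
  by (simp add: tau2_eq tau_linear tau_e) (simp add: tau_eq polar_e e_left_right)

text \<open>After the first factor is expanded by \<open>tau_eq\<close>, two applications of
  linearised flexibility carry \<open>e\<close> to the right of \<open>x \<star> y\<close>.\<close>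

lemma tau_mult: "\<tau> (x \<star> y) = \<tau> x \<star> \<tau> y"
proof -
  have 1: "(x \<star> e) \<star> \<tau> y = b x (\<tau> y) \<cdot> e - (e \<star> y) \<star> x"
    using flexible_left_polar[of x e "\<tau> y"]
    by (simp add: \<tau>_def e_left_right eq_diff_eq)
  have 2: "b x (\<tau> y) = b e x * b e y - b e (x \<star> y)"
    by (simp add: tau_eq[of y] polar_simps polar_sym[of _ e] polar_assoc[symmetric] mult.commute)
  have 3: "e \<star> \<tau> y = b e y \<cdot> e - y"
    using tau2_eq[of "\<tau> y"] by (simp add: tau_cube tau_polar_e algebra_simps)
  have "\<tau> x \<star> \<tau> y = b e x \<cdot> (e \<star> \<tau> y) - (x \<star> e) \<star> \<tau> y"
    by (subst tau_eq[of x]) (simp add: bilinear_simps)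
  then have "\<tau> x \<star> \<tau> y = b e (x \<star> y) \<cdot> e - b e x \<cdot> y + (e \<star> y) \<star> x"
    by (simp add: 1 2 3 algebra_simps)
  also have "\<dots> = b e (x \<star> y) \<cdot> e - (x \<star> y) \<star> e"
    using flexible_left_polar[of x y e] by (simp add: polar_sym[of x e] algebra_simps)
  finally show ?thesis by (simp add: tau_eq)
qed

lemma tau_norm: "n (\<tau> x) = n x"
  by (simp add: \<tau>_def norm_mult norm_e)

lemma tau_polar: "b (\<tau> x) (\<tau> y) = b x y"
  by (simp add: polar_def tau_norm tau_linear(1)[symmetric])

lemma tau_fixed_commutes: "\<tau> x = x \<Longrightarrow> e \<star> x = b e x \<cdot> e - x" "\<tau> x = x \<Longrightarrow> x \<star> e = b e x \<cdot> e - x"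
  using tau_eq[of x] tau2_eq[of x] by (simp_all add: algebra_simps)

section \<open>Splitting into the fixed space of \<tau> and the trace-zero space\<close>

definition trace0 where "trace0 x \<longleftrightarrow> x + \<tau> x + \<tau> (\<tau> x) = 0"

lemma trace0_tau: "trace0 x \<Longrightarrow> trace0 (\<tau> x)"
  by (simp add: trace0_def tau_cube algebra_simps)

lemma trace0_linear:
  "trace0 x \<Longrightarrow> trace0 y \<Longrightarrow> trace0 (x + y)" "trace0 x \<Longrightarrow> trace0 y \<Longrightarrow> trace0 (x - y)"
  "trace0 x \<Longrightarrow> trace0 (c \<cdot> x)"
proof -
  show "trace0 (x + y)" if "trace0 x" "trace0 y"
  proof -
    have "x + y + \<tau> (x + y) + \<tau> (\<tau> (x + y)) = (x + \<tau> x + \<tau> (\<tau> x)) + (y + \<tau> y + \<tau> (\<tau> y))"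
      by (simp add: tau_linear algebra_simps)
    then show ?thesis using that unfolding trace0_def by simp
  qed
  show *: "trace0 (c \<cdot> x)" if "trace0 x" for c x
    using that by (simp add: trace0_def tau_linear scale_right_distrib[symmetric])
  show "trace0 (x - y)" if "trace0 x" "trace0 y"
  proof -
    have "x - y + \<tau> (x - y) + \<tau> (\<tau> (x - y)) = (x + \<tau> x + \<tau> (\<tau> x)) - (y + \<tau> y + \<tau> (\<tau> y))"
      by (simp add: tau_linear algebra_simps)
    then show ?thesis using that unfolding trace0_def by simp
  qed
qed

lemma trace0_diff: "trace0 (x - \<tau> x)"
  by (simp add: trace0_def tau_linear tau_cube)

lemma trace0_tau2: "trace0 x \<Longrightarrow> \<tau> (\<tau> x) = - x - \<tau> x"
  by (simp add: trace0_def algebra_simps add_eq_0_iff)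

lemma tau_fixed_mult_trace0:
  assumes "\<tau> q = q" "trace0 x"
  shows "trace0 (q \<star> x)" "trace0 (x \<star> q)"
  using assms by (simp_all add: trace0_def tau_mult bilinear_simps(1,2)[symmetric])
    (simp_all add: bilinear_simps(7,8))

text \<open>Together with \<open>proj1\<close>: the projections onto N and Q multiplied by 3, so
  that no division occurs.\<close>

definition proj0 where "proj0 x = x + x - \<tau> x - \<tau> (\<tau> x)"
definition proj1 where "proj1 x = x + \<tau> x + \<tau> (\<tau> x)"

lemma proj_add: "proj1 x + proj0 x = 3 \<cdot> x"
proof -
  have "(3::'f) = 1 + 1 + 1" by simp
  then have "3 \<cdot> x = x + x + x" by (simp only: scale_left_distrib scale_one)
  then show ?thesis by (simp add: proj0_def proj1_def algebra_simps)
qed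

lemma proj1_fixed: "\<tau> (proj1 x) = proj1 x"
  by (simp add: proj1_def tau_linear tau_cube algebra_simps)

lemma proj0_trace0: "trace0 (proj0 x)"
  by (simp add: proj0_def trace0_def tau_linear tau_cube algebra_simps)

end

subsection \<open>Okubo algebras in characteristic different from 3\<close>

text \<open>Apart from the condition on the characteristic, these properties descend from the split
  Okubo algebra. \<open>center_zero\<close> keeps \<tau> from being the identity, and
  \<open>dim_8\<close> rules out Peirce spaces that are too small.\<close>

locale okubo_composition = symmetric_composition A
  for A :: "('f::field, 'v::ab_group_add) normed_algebra" +
  assumes three: "(3::'f) \<noteq> 0"
    and cyclic: "amult A (amult A x y) z + amult A (amult A y z) x + amult A (amult A z x) y
      = amult A x (amult A y z) + amult A y (amult A z x) + amult A z (amult A x y)"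
    and nondegenerate: "(\<And>y. polar (anorm A) x y = 0) \<Longrightarrow> x = 0"
    and center_zero: "(\<And>y. amult A x y = amult A y x) \<Longrightarrow> x = 0"
    and dim_8: "dim UNIV = 8"

locale idempotent_okubo = okubo_composition A + idempotent_composition A e
  for A :: "('f::field, 'v::ab_group_add) normed_algebra" and e
begin

text \<open>The polar form is \<tau>-invariant, so pairing the zero sum over the orbit of
  \<open>x\<close> with \<open>q\<close> gives \<open>3 * b q x = 0\<close>.\<close>

lemma tau_fixed_orth:
  assumes "\<tau> q = q" "trace0 x" shows "b q x = 0"
proof -
  have "b q (\<tau> x) = b q x" "b q (\<tau> (\<tau> x)) = b q x" using tau_polar[of q] assms(1) by metis+
  then have "b q (x + \<tau> x + \<tau> (\<tau> x)) = 3 * b q x" by (simp add: polar_simps)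
  then have "3 * b q x = 0" using assms unfolding trace0_def by (simp add: polar_simps(7))
  then show ?thesis using three by simp
qed

lemma trace0_e: "trace0 x \<Longrightarrow> b e x = 0" "trace0 x \<Longrightarrow> e \<star> x = - \<tau> (\<tau> x)" "trace0 x \<Longrightarrow> x \<star> e = - \<tau> x"
  using tau_fixed_orth[OF tau_e] tau_eq[of x] tau2_eq[of x] by simp_all

lemma triple_zero: "x + x + x = (0::'v) \<Longrightarrow> x = 0"
proof -
  assume h: "x + x + x = 0"
  have "(3::'f) = 1 + 1 + 1" by simp
  then have "3 \<cdot> x = x + x + x" by (simp only: scale_left_distrib scale_one)
  then show ?thesis using three h by simp
qed

text \<open>The cyclic identity at \<open>z = e\<close> says \<open>2p = q\<close> for \<open>p = x * y + x * \<tau> y + \<tau> x * y\<close> and its mirror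
  image \<open>q\<close>; by symmetry \<open>2q = p\<close>, hence \<open>3p = 0\<close>.\<close>

lemma trace0_products_aux:
  assumes "trace0 x" "trace0 y"
  shows "(x \<star> y + x \<star> \<tau> y + \<tau> x \<star> y) + (x \<star> y + x \<star> \<tau> y + \<tau> x \<star> y) = y \<star> x + \<tau> y \<star> x + y \<star> \<tau> x"
proof -
  let ?p = "x \<star> y"
  have c: "?p \<star> e + (y \<star> e) \<star> x + (e \<star> x) \<star> y = x \<star> (y \<star> e) + y \<star> (e \<star> x) + e \<star> ?p"
    by (rule cyclic)
  \<comment> \<open>Subtracting the formulas for \<tau> and its square cancels the multiples of
    \<open>e\<close> and expresses the commutator with \<open>e\<close> by \<tau>.\<close>
  have "?p \<star> e - e \<star> ?p = \<tau> (\<tau> ?p) - \<tau> ?p"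
    by (simp only: tau2_eq[of ?p]) (simp add: tau_eq[of ?p])
  also have "\<dots> = (x + \<tau> x) \<star> (y + \<tau> y) - \<tau> x \<star> \<tau> y"
    using assms by (simp add: tau_mult trace0_tau2 bilinear_simps algebra_simps)
  finally have d: "?p \<star> e = e \<star> ?p + x \<star> y + x \<star> \<tau> y + \<tau> x \<star> y"
    by (simp add: bilinear_simps algebra_simps)
  show ?thesis using c unfolding d
    using assms by (simp add: trace0_e trace0_tau2 bilinear_simps algebra_simps)
qed

lemma trace0_products:
  assumes "trace0 x" "trace0 y"
  shows "\<tau> (x \<star> y) = x \<star> y"
proof -
  have z: "x \<star> y + x \<star> \<tau> y + \<tau> x \<star> y = 0" if "trace0 x" "trace0 y" for x y
  proof -
    define p q where "p = x \<star> y + x \<star> \<tau> y + \<tau> x \<star> y" and "q = y \<star> x + y \<star> \<tau> x + \<tau> y \<star> x"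
    have "p + p = q" "q + q = p" using trace0_products_aux[of x y] trace0_products_aux[of y x] that
      by (simp_all add: p_def q_def algebra_simps)
    then have "p + p + p = 0" by (metis add.assoc add_cancel_right_right)
    then show ?thesis using triple_zero p_def by blast
  qed
  \<comment> \<open>For the pair \<open>x\<close>, \<open>\<tau> y\<close> the vanishing sum
    collapses to \<open>\<tau> x \<star> \<tau> y - x \<star> y\<close>, because
    \<open>\<tau> (\<tau> y) = - y - \<tau> y\<close>.\<close>
  have "x \<star> \<tau> y + x \<star> \<tau> (\<tau> y) + \<tau> x \<star> \<tau> y = 0" using z[of x "\<tau> y"] assms trace0_tau by blast
  then show ?thesis using assms
    by (simp add: tau_mult trace0_tau2 bilinear_simps algebra_simps)
qed

text \<open>Q is orthogonal to N, and \<open>3 \<cdot> z\<close> differs from \<open>proj1 z\<close>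
  by an element of N, so a witness of nondegeneracy may be projected to Q.\<close>

lemma fixed_nondegenerate:
  assumes "\<tau> q = q" "q \<noteq> 0"
  obtains y where "\<tau> y = y" "b q y \<noteq> 0"
proof -
  obtain z where z: "b q z \<noteq> 0" using assms nondegenerate by blast
  have "b q (proj1 z) = b q (3 \<cdot> z)"
    unfolding proj_add[symmetric] using tau_fixed_orth[OF assms(1) proj0_trace0]
    by (simp add: polar_simps)
  then show ?thesis using that[of "proj1 z"] z three by (simp add: proj1_fixed polar_simps)
qed

lemma trace0_nondegenerate:
  assumes "trace0 m" "m \<noteq> 0"
  obtains y where "trace0 y" "b m y \<noteq> 0"
proof -
  obtain z where z: "b m z \<noteq> 0" using assms nondegenerate by blast
  have "b m (proj0 z) = b m (3 \<cdot> z)"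
    unfolding proj_add[symmetric] using tau_fixed_orth[OF proj1_fixed assms(1), of z]
    by (simp add: polar_simps polar_sym[of m "proj1 z"])
  then show ?thesis using that[of "proj0 z"] z three by (simp add: proj0_trace0 polar_simps)
qed

section \<open>Isotropic elements with cubic value 1\<close>

lemma cube_one_if_fixed_isotropic:
  assumes "\<tau> q = q" "q \<noteq> 0" "n q = 0"
  shows "\<exists>x. n x = 0 \<and> b x (x \<star> x) = 1"
proof -
  obtain y where y: "\<tau> y = y" "b q y \<noteq> 0" using fixed_nondegenerate assms by blast
  \<comment> \<open>Multiples of the isotropic \<open>q\<close> are isotropic, and the factor
    \<open>e \<star> y\<close> gives the product the trace \<open>b q y\<close>, which is scaled to
    1.\<close>
  define x where "x = (1 / b q y) \<cdot> (q \<star> (e \<star> y))"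
  have "b e (q \<star> (e \<star> y)) = b q y"
    by (metis e_left_right(1) polar_assoc polar_sym)
  then have ex: "b e x = 1" using y by (simp add: x_def polar_simps)
  have nx: "n x = 0" by (simp add: x_def norm_scale norm_mult assms)
  have fx: "\<tau> x = x" by (simp add: x_def tau_linear tau_mult tau_e y assms)
  have "(x \<star> e) \<star> x = 0" by (simp add: flexible_left nx)
  then have "x \<star> x = e - x"
    using tau_fixed_commutes[OF fx] by (simp add: ex bilinear_simps algebra_simps)
  then have "b x (x \<star> x) = 1" by (simp add: polar_simps polar_self nx ex polar_sym[of x e])
  then show ?thesis using nx by blast
qed

lemma cube_one_if_norm_minus_one:
  assumes w: "trace0 w" "n w = -1"
  shows "\<exists>x. n x = 0 \<and> b x (x \<star> x) = 1"
proof -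
  \<comment> \<open>Comparing the norms of \<open>\<tau> (\<tau> w)\<close> and
    \<open>- w - \<tau> w\<close> gives \<open>b w (\<tau> w) = - n w\<close>.\<close>
  have "n (\<tau> (\<tau> w)) = n (- (w + \<tau> w))" using trace0_tau2[OF w(1)] by simp
  then have "n w = n w + n w + b w (\<tau> w)" by (simp only: norm_minus norm_add tau_norm)
  then have "b w (\<tau> w) = 1" using w by simp
  then have wt: "b (\<tau> (\<tau> w)) w = 1" using tau_polar[of "\<tau> (\<tau> w)" w] tau_cube by simp
  have ew: "b e w = 0" "b w e = 0" using trace0_e(1)[OF w(1)] polar_sym by metis+
  have ef: "b e (w \<star> w) = -1"
    using wt by (simp add: polar_assoc[symmetric] trace0_e w polar_simps)
  have wf: "b w (w \<star> w) = 0"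
    using tau_fixed_orth[OF trace0_products[OF w(1) w(1)] w(1)] by (simp add: polar_sym)
  \<comment> \<open>On N, \<open>e \<star> w + w \<star> e = - \<tau> (\<tau> w) - \<tau> w =
    w\<close>.\<close>
  have sq: "(e + w) \<star> (e + w) = e + w + w \<star> w"
    using trace0_e[OF w(1)] trace0_tau2[OF w(1)] by (simp add: bilinear_simps idem)
  have "n (e + w) = 0" by (simp add: norm_add norm_e w ew)
  moreover from this have "b (e + w) ((e + w) \<star> (e + w)) = - 1"
    unfolding sq polar_simps(1)[of _ "e + w"] by (simp add: polar_self polar_simps ef wf)
  ultimately show ?thesis
    \<comment> \<open>The form \<open>b x (x \<star> x)\<close> is cubic, so negating the vector
      corrects the sign.\<close>
    by (intro exI[of _ "- (e + w)"])
      (simp add: norm_minus bilinear_simps(5,6) polar_simps(5,6) del: minus_add_distrib)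
qed

lemma cube_one_if_isotropic:
  assumes "isotropic n"
  shows "\<exists>x. n x = 0 \<and> b x (x \<star> x) = 1"
proof (cases "\<exists>q. \<tau> q = q \<and> q \<noteq> 0 \<and> n q = 0")
  case True
  then show ?thesis using cube_one_if_fixed_isotropic by blast
next
  case False
  obtain z where z: "z \<noteq> 0" "n z = 0" using assms by (auto simp: isotropic_def)
  define q m where "q = proj1 z" and "m = proj0 z"
  have q: "\<tau> q = q" and m: "trace0 m" by (simp_all add: q_def m_def proj1_fixed proj0_trace0)
  have qm: "q + m = 3 \<cdot> z" by (simp add: q_def m_def proj_add)
  have "n (q + m) = 0" by (simp add: qm norm_scale z)
  then have nqm: "n q = - n m" using tau_fixed_orth[OF q m] by (simp add: norm_add eq_neg_iff_add_eq_0)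
  have "n m \<noteq> 0"
  proof
    assume nm: "n m = 0"
    then have "q = 0" using nqm False q by auto
    then have "m \<noteq> 0" using qm z three by auto
    then obtain y where y: "trace0 y" "b m y \<noteq> 0" using trace0_nondegenerate m by blast
    \<comment> \<open>The norms of \<open>y\<close> and \<open>m + y\<close> differ by
      \<open>b m y\<close>, so one of them is nonzero.\<close>
    obtain w where w: "trace0 w" "n w \<noteq> 0"
      using y m norm_add[of m y] nm trace0_linear(1) by (metis add.left_neutral)
    \<comment> \<open>Multiplication by the anisotropic \<open>w\<close> is injective, so
      \<open>w \<star> m\<close> would be a nonzero isotropic element of Q.\<close>
    have "w \<star> m \<noteq> 0" using flexible_left[of w m] w \<open>m \<noteq> 0\<close> by (auto simp: bilinear_simps)
    moreover have "n (w \<star> m) = 0" by (simp add: norm_mult nm)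
    ultimately show False using False trace0_products[OF w(1) m] by blast
  qed
  \<comment> \<open>The norm of \<open>q \<star> m\<close> is minus the square of
    \<open>n q\<close>, hence the factor.\<close>
  define w where "w = (1 / n q) \<cdot> (q \<star> m)"
  have "trace0 w" unfolding w_def by (intro trace0_linear tau_fixed_mult_trace0 q m)
  moreover have "n w = -1"
    using \<open>n m \<noteq> 0\<close> by (simp add: w_def norm_scale norm_mult norm_minus nqm power2_eq_square)
  ultimately show ?thesis by (rule cube_one_if_norm_minus_one)
qed
end

subsection \<open>Peirce decomposition\<close>

text \<open>In the split Okubo algebra conjugation interchanges the Cayley idempotents, which
  therefore become squares of each other.\<close>

locale cube_frame = symmetric_composition A
  for A :: "('f::field, 'v::ab_group_add) normed_algebra" +
  fixes e1 e2 :: 'v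
  assumes norm_e1: "anorm A e1 = 0" and norm_e2: "anorm A e2 = 0"
    and e1_square: "amult A e1 e1 = e2" and e2_square: "amult A e2 e2 = e1"
    and polar_e12: "polar (anorm A) e1 e2 = 1"
begin

lemma swap: "cube_frame A e2 e1"
  using norm_e1 norm_e2 e1_square e2_square polar_e12 polar_sym by unfold_locales auto

lemma e_products: "e1 \<star> e2 = 0" "e2 \<star> e1 = 0"
  using flexible_left[of e1 e1] flexible_right[of e1 e1] by (simp_all add: e1_square norm_e1)

sublocale idempotent_composition A "e1 + e2"
proof
  show "(e1 + e2) \<star> (e1 + e2) = e1 + e2"
    by (simp add: bilinear_simps e_products e1_square e2_square)
  have "b e1 (e1 + e2) = 1" by (simp add: polar_simps polar_self norm_e1 polar_e12)
  then show "e1 + e2 \<noteq> 0" by (metis polar_simps(7) zero_neq_one)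
qed

text \<open>\<open>U\<close> will be the span of the \<open>u\<^sub>i\<close>, where \<open>nxt\<close> is \<open>\<tau>\<close>. All hypotheses are symmetric in \<open>e1\<close> and
  \<open>e2\<close>; the span of the \<open>v\<^sub>i\<close> is the instance \<open>swap.U\<close> obtained by exchanging them.\<close>

definition U where "U u \<longleftrightarrow> e1 \<star> u = 0 \<and> b e1 u = 0"

definition nxt where "nxt u = - (u \<star> e1)"

lemma U_D:
  assumes "U u"
  shows "e1 \<star> u = 0" "b e1 u = 0" "b u e1 = 0" "b e2 u = 0" "b u e2 = 0" "u \<star> e2 = 0" "n u = 0"
proof -
  show 1: "e1 \<star> u = 0" "b e1 u = 0" "b u e1 = 0" using assms polar_sym by (auto simp: U_def)
  have "b e2 u = b e1 (e1 \<star> u)" by (simp flip: e1_square add: polar_assoc)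
  then show "b e2 u = 0" "b u e2 = 0" using 1 polar_sym by (simp_all add: polar_simps)
  show "u \<star> e2 = 0" using flexible_right_polar[of u e1 e1] 1 by (simp add: e1_square bilinear_simps)
  have "u \<star> (e1 \<star> u) = n u \<cdot> e1" by (rule flexible_right)
  moreover have "e1 \<noteq> 0" using polar_e12 by (auto simp: polar_simps)
  ultimately show "n u = 0" using 1 by (simp add: bilinear_simps)
qed

lemma U_linear: "U x \<Longrightarrow> U y \<Longrightarrow> U (x + y)" "U x \<Longrightarrow> U y \<Longrightarrow> U (x - y)" "U x \<Longrightarrow> U (c \<cdot> x)"
  by (simp_all add: U_def bilinear_simps polar_simps)

lemma U_isotropic: "U x \<Longrightarrow> U y \<Longrightarrow> b x y = 0"
  using U_D(7) U_linear(1) by (simp add: polar_def)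

lemma U_nxt: "U u \<Longrightarrow> U (nxt u)"
proof -
  assume u: "U u"
  have "b e1 (u \<star> e1) = b u e2" by (metis e1_square polar_assoc polar_sym)
  then show ?thesis using U_D[OF u]
    by (simp add: U_def nxt_def bilinear_simps polar_simps flexible_right norm_e1)
qed

text \<open>Linearised flexibility trades two right multiplications by \<open>e1\<close> for one
  left multiplication by \<open>e2\<close>.\<close>

lemma nxt_nxt: "U u \<Longrightarrow> nxt (nxt u) = - (e2 \<star> u)"
  using flexible_left_polar[of u e1 e1]
  by (simp add: nxt_def e1_square bilinear_simps U_D eq_neg_iff_add_eq_0)

lemma nxt_cube: "U u \<Longrightarrow> nxt (nxt (nxt u)) = u"
  using flexible_left_polar[of e2 u e1]
  by (simp add: nxt_nxt) (simp add: nxt_def bilinear_simps U_D polar_e12 polar_sym[of e2 e1])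

lemma tau_U: "U u \<Longrightarrow> \<tau> u = nxt u"
  by (simp add: tau_eq nxt_def polar_simps U_D bilinear_simps)

text \<open>The right-hand side is the shift of \<open>u \<star> u\<close> in the exchanged frame:
  squaring carries the shift of the \<open>u\<^sub>i\<close> to that of the
  \<open>v\<^sub>i\<close>.\<close>

lemma nxt_square: "U u \<Longrightarrow> nxt u \<star> nxt u = - ((u \<star> u) \<star> e2)"
proof -
  assume u: "U u"
  have "(u \<star> e1) \<star> (u \<star> e1) + ((u \<star> e1) \<star> e1) \<star> u = b u (u \<star> e1) \<cdot> e1"
    by (rule flexible_left_polar)
  moreover have "(u \<star> e1) \<star> e1 = - (e2 \<star> u)"
    using nxt_nxt[OF u] by (simp add: nxt_def bilinear_simps)
  moreover have "(e2 \<star> u) \<star> u = - ((u \<star> u) \<star> e2)"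
    using flexible_left_polar[of e2 u u] U_D[OF u] by (simp add: eq_neg_iff_add_eq_0)
  moreover have "b u (u \<star> e1) = 0" using U_isotropic[OF u U_nxt[OF u]] by (simp add: nxt_def polar_simps)
  ultimately show ?thesis by (simp add: nxt_def bilinear_simps add_eq_0_iff2)
qed

end

sublocale cube_frame \<subseteq> swap: cube_frame A e2 e1
  by (rule swap)

context cube_frame
begin

lemma U_square:
  assumes u: "U u" shows "swap.U (u \<star> u)"
proof -
  have "e2 \<star> (u \<star> u) = 0"
    using flexible_right_polar[of e2 u u] U_D[OF u] by (simp add: bilinear_simps)
  moreover have "b e2 (u \<star> u) = 0"
    using U_D[OF u] by (metis polar_rotate polar_sym polar_simps(7))
  ultimately show ?thesis by (simp add: swap.U_def)
qed

lemma nxt_square_swap: "U u \<Longrightarrow> nxt u \<star> nxt u = swap.nxt (u \<star> u)"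
  by (simp add: nxt_square swap.nxt_def)

lemma cube_nxt: "U u \<Longrightarrow> b (nxt u) (nxt u \<star> nxt u) = b u (u \<star> u)"
  using tau_polar[of u "u \<star> u"] tau_U tau_mult by metis

lemma square_square: "U u \<Longrightarrow> b u (u \<star> u) = 1 \<Longrightarrow> (u \<star> u) \<star> (u \<star> u) = u"
  by (simp add: square_of_square U_D)

text \<open>The row of \<open>u\<^sub>1\<close> in the multiplication table. A shift is a
  multiplication by \<open>e1\<close> or \<open>e2\<close>, which linearised flexibility moves past
  \<open>u\<close>; further rows follow by shifting and by exchanging \<open>e1\<close> and
  \<open>e2\<close>.\<close>

lemma products_U:
  assumes u: "U u" and g: "b u (u \<star> u) = 1"
  shows "u \<star> nxt (nxt u) = 0" "u \<star> nxt u = - swap.nxt (swap.nxt (u \<star> u))"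
    "u \<star> (u \<star> u) = 0" "u \<star> swap.nxt (u \<star> u) = 0" "u \<star> swap.nxt (swap.nxt (u \<star> u)) = - e1"
    "e1 \<star> u = 0" "u \<star> e2 = 0" "e2 \<star> u = - nxt (nxt u)" "u \<star> e1 = - nxt u"
proof -
  note v = U_square[OF u]
  show "e1 \<star> u = 0" "u \<star> e2 = 0" by (simp_all add: U_D u)
  show "e2 \<star> u = - nxt (nxt u)" "u \<star> e1 = - nxt u" by (simp add: nxt_nxt u, simp add: nxt_def)
  show "u \<star> nxt (nxt u) = 0" by (simp add: nxt_nxt u bilinear_simps flexible_right U_D)
  show uv: "u \<star> (u \<star> u) = 0" by (simp add: flexible_right U_D u)
  have "u \<star> (u \<star> e1) + e1 \<star> (u \<star> u) = b u e1 \<cdot> u" by (rule flexible_right_polar)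
  then show "u \<star> nxt u = - swap.nxt (swap.nxt (u \<star> u))"
    by (simp add: swap.nxt_nxt v nxt_def bilinear_simps U_D u add_eq_0_iff2)
  have "u \<star> ((u \<star> u) \<star> e2) + e2 \<star> ((u \<star> u) \<star> u) = b u e2 \<cdot> (u \<star> u)" by (rule flexible_right_polar)
  then show "u \<star> swap.nxt (u \<star> u) = 0"
    by (simp add: swap.nxt_def U_D u flexible_left bilinear_simps)
  have "u \<star> (e1 \<star> (u \<star> u)) + (u \<star> u) \<star> (e1 \<star> u) = b u (u \<star> u) \<cdot> e1" by (rule flexible_right_polar)
  then show "u \<star> swap.nxt (swap.nxt (u \<star> u)) = - e1"
    by (simp add: swap.nxt_nxt v g bilinear_simps U_D u)
qed

lemma polar_U:
  assumes u: "U u" and g: "b u (u \<star> u) = 1"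
  shows "b u (swap.nxt (u \<star> u)) = 0" "b u (swap.nxt (swap.nxt (u \<star> u))) = 0"
proof -
  show "b u (swap.nxt (u \<star> u)) = 0"
    by (simp add: swap.nxt_def polar_simps polar_assoc[symmetric] products_U[OF u g])
  have "b u (e1 \<star> (u \<star> u)) = b (u \<star> u) (u \<star> e1)" by (metis polar_assoc polar_sym)
  also have "\<dots> = b ((u \<star> u) \<star> u) e1" by (simp add: polar_assoc)
  finally show "b u (swap.nxt (swap.nxt (u \<star> u))) = 0"
    by (simp add: swap.nxt_nxt U_square u polar_simps flexible_left U_D)
qed

text \<open>Indices lie in the type \<open>3\<close>, where 3 = 0, so the last branches are index 3
  and the shift is cyclic.\<close>

definition frame :: "'v \<Rightarrow> cayley_index \<Rightarrow> 'v" where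
  "frame u i = (case i of Ie1 \<Rightarrow> e1 | Ie2 \<Rightarrow> e2
     | Iu j \<Rightarrow> (if j = 1 then u else if j = 2 then nxt u else nxt (nxt u))
     | Iv j \<Rightarrow> (let v = u \<star> u in if j = 1 then v else if j = 2 then swap.nxt v else swap.nxt (swap.nxt v)))"

end

subsection \<open>The canonical basis\<close>

text \<open>The Petersson product in the canonical basis: conjugation swaps \<open>Ie1\<close> and
  \<open>Ie2\<close> and negates the other vectors, and \<open>tau_st\<close> shifts the two factors
  by one and two places.\<close>

fun okubo_table :: "cayley_index \<Rightarrow> cayley_index \<Rightarrow> 'f::field ^ cayley_index" where
  "okubo_table Ie1 Ie1 = cayley_basis Ie2"
| "okubo_table Ie2 Ie2 = cayley_basis Ie1"
| "okubo_table Ie1 (Iv i) = - cayley_basis (Iv (i + 2))"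
| "okubo_table Ie2 (Iu i) = - cayley_basis (Iu (i + 2))"
| "okubo_table (Iu i) Ie1 = - cayley_basis (Iu (i + 1))"
| "okubo_table (Iv i) Ie2 = - cayley_basis (Iv (i + 1))"
| "okubo_table (Iu i) (Iu j) =
     (if j = i then cayley_basis (Iv i) else if j = i + 1 then - cayley_basis (Iv (i + 2)) else 0)"
| "okubo_table (Iv i) (Iv j) =
     (if j = i then cayley_basis (Iu i) else if j = i + 1 then - cayley_basis (Iu (i + 2)) else 0)"
| "okubo_table (Iu i) (Iv j) = (if j = i + 2 then - cayley_basis Ie1 else 0)"
| "okubo_table (Iv i) (Iu j) = (if j = i + 2 then - cayley_basis Ie2 else 0)"
| "okubo_table _ _ = 0"

lemmas split_okubo_nth = cayley_vec_eq_iff forall_3 split_okubo_mult cayley_mult_nth tau_st_nth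
  conjugation_nth sum_3 three_simps

lemma three_cases: "j = i \<or> j = i + 1 \<or> j = i + 2" for i j :: 3
  using exhaust_3[of i] exhaust_3[of j] by (auto simp: three_simps)

lemma three_distinct: "i + 1 \<noteq> i" "i + 2 \<noteq> i" "i + 2 \<noteq> i + 1" for i :: 3
  using exhaust_3[of i] by (auto simp: three_simps)

lemma split_okubo_basis:
  "amult split_okubo (cayley_basis k) (cayley_basis l) = (okubo_table k l :: 'f::field ^ cayley_index)"
  (is "?P k l")
proof -
  have "\<forall>i. ?P Ie1 (Iu i)" "\<forall>i. ?P Ie1 (Iv i)" "\<forall>i. ?P Ie2 (Iu i)" "\<forall>i. ?P Ie2 (Iv i)"
    "\<forall>i. ?P (Iu i) Ie1" "\<forall>i. ?P (Iv i) Ie1" "\<forall>i. ?P (Iu i) Ie2" "\<forall>i. ?P (Iv i) Ie2"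
    "\<forall>i j. ?P (Iu i) (Iu j)" "\<forall>i j. ?P (Iu i) (Iv j)"
    "\<forall>i j. ?P (Iv i) (Iu j)" "\<forall>i j. ?P (Iv i) (Iv j)"
    "?P Ie1 Ie1" "?P Ie1 Ie2" "?P Ie2 Ie1" "?P Ie2 Ie2"
    by (simp_all add: split_okubo_nth axis_def)
  then show ?thesis by (cases k; cases l) blast+
qed

context cube_frame
begin

context
  fixes u
  assumes u: "U u" and g: "b u (u \<star> u) = 1"
begin

lemma frame_e: "frame u Ie1 = e1" "frame u Ie2 = e2"
  by (simp_all add: frame_def)

lemma frame_nxt: "nxt (frame u (Iu i)) = frame u (Iu (i + 1))"
    "swap.nxt (frame u (Iv i)) = frame u (Iv (i + 1))"
proof -
  have "\<forall>i. nxt (frame u (Iu i)) = frame u (Iu (i + 1))"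
    "\<forall>i. swap.nxt (frame u (Iv i)) = frame u (Iv (i + 1))"
    unfolding forall_3
    by (simp_all add: frame_def nxt_cube u swap.nxt_cube U_square Let_def three_simps)
  then show "nxt (frame u (Iu i)) = frame u (Iu (i + 1))"
    "swap.nxt (frame u (Iv i)) = frame u (Iv (i + 1))" by blast+
qed

lemma frame_nxt2: "nxt (nxt (frame u (Iu i))) = frame u (Iu (i + 2))"
    "swap.nxt (swap.nxt (frame u (Iv i))) = frame u (Iv (i + 2))"
  by (simp_all add: frame_nxt add.assoc)

lemma frame_U: "U (frame u (Iu i))" "frame u (Iv i) = frame u (Iu i) \<star> frame u (Iu i)"
    "b (frame u (Iu i)) (frame u (Iu i) \<star> frame u (Iu i)) = 1"
proof -
  show "U (frame u (Iu i))" by (simp add: frame_def U_nxt u)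
  show "frame u (Iv i) = frame u (Iu i) \<star> frame u (Iu i)"
    by (simp add: frame_def U_nxt u Let_def nxt_square_swap)
  show "b (frame u (Iu i)) (frame u (Iu i) \<star> frame u (Iu i)) = 1"
    by (simp add: frame_def U_nxt u cube_nxt g)
qed

lemma frame_V: "swap.U (frame u (Iv i))" "frame u (Iv i) \<star> frame u (Iv i) = frame u (Iu i)"
    "b (frame u (Iv i)) (frame u (Iv i) \<star> frame u (Iv i)) = 1"
  using U_square[OF frame_U(1)] square_square[OF frame_U(1,3)] frame_U(3)
  by (simp_all add: frame_U(2) polar_sym)

text \<open>Double shifts are rewritten first, so that they appear as \<open>i + 2\<close>, the form
  used in \<open>okubo_table\<close>.\<close>

lemmas frame_U_products = products_U[OF frame_U(1,3), folded frame_U(2), unfolded frame_nxt2, unfolded frame_nxt]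
lemmas frame_V_products = swap.products_U[OF frame_V(1,3), unfolded frame_V(2), unfolded frame_nxt2, unfolded frame_nxt]

section \<open>The linear map from the split Okubo algebra given by the frame\<close>

definition lin where "lin x = (\<Sum>i\<in>UNIV. x $ i \<cdot> frame u i)"

lemma lin_linear: "lin (x + y) = lin x + lin y" "lin (c *s x) = c \<cdot> lin x" "lin (- x) = - lin x" "lin 0 = 0"
  by (simp_all add: lin_def scale_left_distrib sum.distrib scale_sum_right sum_negf)

lemma lin_basis: "lin (cayley_basis i) = frame u i"
proof -
  have "lin (cayley_basis i) = (\<Sum>j\<in>UNIV. if j = i then frame u j else 0)"
    unfolding lin_def by (rule sum.cong) (auto simp: axis_def)
  then show ?thesis by simp
qed

lemma frame_mult: "frame u k \<star> frame u l = lin (okubo_table k l)"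
proof -
  have uu: "frame u (Iu i) \<star> frame u (Iu j) = lin (okubo_table (Iu i) (Iu j))"
     "frame u (Iu i) \<star> frame u (Iv j) = lin (okubo_table (Iu i) (Iv j))"
     "frame u (Iv i) \<star> frame u (Iv j) = lin (okubo_table (Iv i) (Iv j))"
     "frame u (Iv i) \<star> frame u (Iu j) = lin (okubo_table (Iv i) (Iu j))" for i j
    using three_cases[of j i] three_distinct[of i]
    by (auto simp: frame_U_products frame_V_products lin_linear lin_basis frame_U(2)[symmetric] frame_V(2) frame_e)
  show ?thesis
    by (cases k; cases l)
      (simp_all only: uu okubo_table.simps frame_e e1_square e2_square e_products lin_linear lin_basis
       frame_U_products frame_V_products)
qed

lemma lin_mult: "lin (amult split_okubo x y) = lin x \<star> lin y"
proof -
  have 1: "lin (amult split_okubo (cayley_basis i) (cayley_basis j)) = lin (cayley_basis i) \<star> lin (cayley_basis j)" for i j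
    by (simp only: split_okubo_basis frame_mult lin_basis)
  have sp: "vec.span (range cayley_basis :: ('f ^ cayley_index) set) = UNIV"
    using vec.span_Basis by (simp add: cart_basis_def full_SetCompr_eq)
  have bil: "amult split_okubo (c *s x + y) z = c *s amult split_okubo x z + amult split_okubo y z"
    "amult split_okubo z (c *s x + y) = c *s amult split_okubo z x + amult split_okubo z y"
    "amult split_okubo 0 z = 0" "amult split_okubo z 0 = 0"
    for c :: 'f and x y z
    by (simp_all add: split_okubo_nth algebra_simps)
  have 2: "lin (amult split_okubo (cayley_basis i) y) = lin (cayley_basis i) \<star> lin y" for i y
    by (rule span_UNIV_induct[OF vec.vector_space_axioms sp])
      (auto simp: bil lin_linear bilinear_simps 1)
  show ?thesis
    by (rule span_UNIV_induct[OF vec.vector_space_axioms sp, where P = "\<lambda>x. lin (amult split_okubo x y) = lin x \<star> lin y"])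
      (auto simp: bil lin_linear bilinear_simps 2)
qed

lemma frame_polar:
  "b (frame u (Iu i)) (frame u (Iu j)) = 0" "b (frame u (Iv i)) (frame u (Iv j)) = 0"
  "b (frame u (Iu i)) (frame u (Iv j)) = (if i = j then 1 else 0)"
  "b e1 (frame u (Iu i)) = 0" "b e2 (frame u (Iu i)) = 0" "b e1 (frame u (Iv i)) = 0" "b e2 (frame u (Iv i)) = 0"
  using U_isotropic[OF frame_U(1) frame_U(1)] swap.U_isotropic[OF frame_V(1) frame_V(1)]
    polar_U[OF frame_U(1,3)[of i], folded frame_U(2), unfolded frame_nxt2, unfolded frame_nxt]
    U_D[OF frame_U(1)] swap.U_D[OF frame_V(1)] three_cases[of j i] three_distinct[of i] frame_U(3)[of i, folded frame_U(2)]
  by auto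

lemma lin_sum: "lin x = x $ Ie1 \<cdot> e1 + x $ Ie2 \<cdot> e2
   + x $ Iu 1 \<cdot> frame u (Iu 1) + x $ Iu 2 \<cdot> frame u (Iu 2) + x $ Iu 3 \<cdot> frame u (Iu 3) +
   x $ Iv 1 \<cdot> frame u (Iv 1) + x $ Iv 2 \<cdot> frame u (Iv 2) + x $ Iv 3 \<cdot> frame u (Iv 3)"
  by (simp add: lin_def sum_cayley_index sum_3 frame_e add.assoc)

lemma lin_norm: "n (lin x) = anorm split_okubo x"
  unfolding lin_sum
  by (simp add: norm_add norm_scale norm_e1 norm_e2 polar_simps frame_polar polar_sym[of "frame u _" e1] polar_e12
     polar_sym[of "frame u _" e2] polar_sym[of "frame u (Iv _)" "frame u (Iu _)"] U_D(7)[OF frame_U(1)] swap.U_D(7)[OF frame_V(1)]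
     split_okubo_sel anorm_cayley sum_3 algebra_simps)

text \<open>The frame is its own dual basis up to order under the polar form, so pairing
  \<open>lin x\<close> with frame vectors reads off all coordinates.\<close>

lemma lin_inj: "inj lin"
proof -
  have "x = 0" if "lin x = 0" for x
  proof -
    have c: "b (lin x) z = 0" for z by (simp add: that polar_simps)
    have "\<forall>i. x $ Iu i = 0" "\<forall>i. x $ Iv i = 0" "x $ Ie1 = 0" "x $ Ie2 = 0"
      unfolding forall_3
      using c[of e1] c[of e2] c[of "frame u (Iu 1)"] c[of "frame u (Iu 2)"] c[of "frame u (Iu 3)"]
       c[of "frame u (Iv 1)"] c[of "frame u (Iv 2)"] c[of "frame u (Iv 3)"] unfolding lin_sum
      by (simp_all add: polar_simps frame_polar polar_sym[of "frame u _" e1] polar_e12 polar_self norm_e1 norm_e2 polar_sym[of e2 e1]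
     U_D(7)[OF frame_U(1)] swap.U_D(7)[OF frame_V(1)]
     polar_sym[of "frame u _" e2] polar_sym[of "frame u (Iv _)" "frame u (Iu _)"])
    then show ?thesis by (simp add: cayley_vec_eq_iff)
  qed
  then show ?thesis
    by (intro injI) (metis (no_types) add.right_inverse eq_neg_iff_add_eq_0 lin_linear(1,3) minus_minus)
qed

end
end

section \<open>Projections onto the Peirce spaces\<close>

context cube_frame
begin

text \<open>Both frames have the same idempotent \<open>e1 + e2\<close>, so they share Q and
  N.\<close>

lemma swap_tau: "swap.\<tau> = \<tau>"
  by (simp add: fun_eq_iff swap.\<tau>_def \<tau>_def add.commute)

lemma swap_trace0: "swap.trace0 = trace0"
  by (simp add: fun_eq_iff swap.trace0_def trace0_def swap_tau)

lemma tau_e1: "\<tau> e1 = e1"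
  by (simp add: tau_eq polar_simps polar_self norm_e1 polar_e12 polar_sym[of e2 e1] bilinear_simps
      e_products e1_square)

lemma tau_e2: "\<tau> e2 = e2"
  by (simp add: tau_eq polar_simps polar_self norm_e2 polar_e12 bilinear_simps e_products e2_square)

text \<open>Taking \<open>z\<close> to \<open>e2 \<star> (z \<star> e1)\<close> fixes
  \<open>U\<close> and \<open>e1\<close> and kills \<open>e2\<close> and \<open>swap.U\<close>;
  removing the \<open>e1\<close> component leaves the projection onto \<open>U\<close>.\<close>

definition proj_U where "proj_U z = e2 \<star> (z \<star> e1) - b e2 z \<cdot> e1"

lemma proj_U: "U (proj_U z)"
proof -
  have "e1 \<star> (e2 \<star> (z \<star> e1)) = b e1 (z \<star> e1) \<cdot> e2"
    using flexible_right_polar[of e1 e2 "z \<star> e1"] by (simp add: e_products bilinear_simps)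
  also have "b e1 (z \<star> e1) = b e2 z" by (metis polar_assoc polar_sym e1_square)
  finally have "e1 \<star> (proj_U z) = 0" by (simp add: proj_U_def bilinear_simps e1_square)
  moreover have "b e1 (proj_U z) = 0"
    by (simp add: proj_U_def polar_simps polar_assoc[symmetric] e_products bilinear_simps polar_self norm_e1)
  ultimately show ?thesis by (simp add: U_def)
qed

end

context cube_frame
begin

text \<open>Since \<open>b e1 e2 = 1\<close>, linearised flexibility writes \<open>z\<close> as
  \<open>e1 \<star> (z \<star> e2) + e2 \<star> (z \<star> e1)\<close>.\<close>

lemma decompose: "z = b e2 z \<cdot> e1 + b e1 z \<cdot> e2 + proj_U z + swap.proj_U z"
  using flexible_right_polar[of e1 z e2] by (simp add: proj_U_def swap.proj_U_def polar_e12 add.commute)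

lemma U_mult:
  assumes "U x" "U y" shows "swap.U (x \<star> y)"
proof -
  have "e2 \<star> (x \<star> y) = 0"
    using flexible_right_polar[of e2 x y] U_D[OF assms(1)] U_D[OF assms(2)] by (simp add: bilinear_simps)
  moreover have "b e2 (x \<star> y) = 0"
    using polar_rotate[of x y e2] U_D[OF assms(2)] by (simp add: polar_sym[of e2] polar_simps)
  ultimately show ?thesis by (simp add: swap.U_def)
qed

lemma polar_swap_U: "swap.U v \<Longrightarrow> b v z = b v (proj_U z)"
  by (subst decompose[of z])
    (simp add: polar_simps swap.U_D swap.U_isotropic[OF _ swap.proj_U])

end

subsection \<open>Existence of a generator\<close>

locale okubo_frame = okubo_composition A + cube_frame A e1 e2
  for A :: "('f::field, 'v::ab_group_add) normed_algebra" and e1 e2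
begin

lemma okubo_swap: "okubo_frame A e2 e1"
  by (intro okubo_frame.intro swap okubo_composition_axioms)

sublocale idempotent_okubo A "e1 + e2" ..

end

sublocale okubo_frame \<subseteq> swap: okubo_frame A e2 e1
  by (rule okubo_swap)

context okubo_frame
begin

lemma trace0_proj_U: "trace0 m \<Longrightarrow> trace0 (proj_U m)"
  by (simp add: proj_U_def tau_fixed_orth[OF tau_e2] tau_fixed_mult_trace0 tau_e1 tau_e2)

text \<open>A witness of nondegeneracy in N is projected to \<open>U\<close>; it stays in N and
  keeps its pairing with \<open>v\<close>.\<close>

lemma trace0_swap_U_nondegenerate:
  assumes "swap.U v" "trace0 v" "v \<noteq> 0"
  obtains y where "U y" "trace0 y" "b y v \<noteq> 0"
proof -
  obtain m where "trace0 m" "b v m \<noteq> 0" using trace0_nondegenerate assms by blast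
  then show ?thesis
    using that[of "proj_U m"] assms polar_swap_U[of v m] proj_U trace0_proj_U polar_sym by metis
qed

end

context okubo_frame
begin

lemma trace0_U_nondegenerate:
  assumes "U y" "trace0 y" "y \<noteq> 0"
  obtains v where "swap.U v" "trace0 v" "b v y \<noteq> 0"
  using swap.trace0_swap_U_nondegenerate[unfolded swap_trace0] assms by blast

text \<open>Some \<open>z\<close> does not commute with \<open>e1 + e2\<close>, so
  \<open>z - \<tau> z\<close> is a nonzero element of N, and it is orthogonal to \<open>e1\<close>
  and \<open>e2\<close>. A nonzero \<open>U\<close> component serves directly, a nonzero
  \<open>swap.U\<close> component through its pairing with \<open>U\<close>.\<close>

lemma trace0_U_exists:
  obtains y where "U y" "trace0 y" "y \<noteq> 0"
proof -
  obtain z where z: "(e1 + e2) \<star> z \<noteq> z \<star> (e1 + e2)" using center_zero e_nonzero by blast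
  define m where "m = z - \<tau> z"
  have m: "trace0 m" by (simp add: m_def trace0_diff)
  have "m \<noteq> 0" using z tau_fixed_commutes[of z] by (auto simp: m_def)
  have "b e1 m = 0" "b e2 m = 0" using tau_fixed_orth m tau_e1 tau_e2 by auto
  then have "m = proj_U m + swap.proj_U m" using decompose[of m] by simp
  then consider "proj_U m \<noteq> 0" | "swap.proj_U m \<noteq> 0" using \<open>m \<noteq> 0\<close> by fastforce
  then show ?thesis
  proof cases
    case 1
    then show ?thesis using that proj_U trace0_proj_U m by blast
  next
    case 2
    then show ?thesis
      using trace0_swap_U_nondegenerate[OF swap.proj_U _ 2] swap.trace0_proj_U[unfolded swap_trace0, OF m] that
      by (metis polar_simps(8))
  qed
qed

lemma U_proj: "U u \<Longrightarrow> U (proj1 u)" "U u \<Longrightarrow> U (proj0 u)"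
  unfolding proj1_def proj0_def by (simp_all add: tau_U U_nxt U_linear)

text \<open>If all these squares vanished, the trace-zero part of \<open>U\<close> would annihilate
  \<open>U\<close> from the left; then both Peirce spaces would be lines and the dimension at most
  4.\<close>

lemma trace0_U_square_exists:
  obtains y where "U y" "trace0 y" "y \<star> y \<noteq> 0"
proof (rule ccontr)
  note witness = that
  assume "\<not> thesis"
  have sq: "y \<star> y = 0" if "U y" "trace0 y" for y using witness[OF that] \<open>\<not> thesis\<close> by blast
  have anti: "y \<star> y' = - (y' \<star> y)" if "U y" "trace0 y" "U y'" "trace0 y'" for y y'
    using sq[of "y + y'"] sq[of y] sq[of y'] that
    by (simp add: U_linear trace0_linear bilinear_simps eq_neg_iff_add_eq_0 add.commute)
  \<comment> \<open>The idempotent acts as -1 on \<open>y \<star> y'\<close>, which is fixed by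
    \<tau> and orthogonal to it. With \<open>anti\<close> this gives
    \<open>y' \<star> (\<tau> y - y) = 0\<close>.\<close>
  have twist: "y' \<star> \<tau> y = - (y \<star> y')" if y: "U y" "trace0 y" "U y'" "trace0 y'" for y y'
  proof -
    let ?e = "e1 + e2"
    have "b y' ?e = 0" using trace0_e(1)[OF y(4)] polar_sym by metis
    then have "y' \<star> (y \<star> ?e) + ?e \<star> (y \<star> y') = 0"
      using flexible_right_polar[of y' y ?e] by (simp only: scale_zero_left)
    moreover have "y \<star> ?e = - \<tau> y" using y trace0_e by blast
    moreover have "b ?e (y \<star> y') = 0"
    proof -
      have "b ?e (y \<star> y') = b (?e \<star> y) y'" by (simp only: polar_assoc)
      also have "\<dots> = - b (\<tau> (\<tau> y)) y'" by (simp only: trace0_e(2)[OF y(2)] polar_simps)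
      also have "b (\<tau> (\<tau> y)) y' = 0" using y by (simp add: tau_U U_nxt U_isotropic)
      finally show ?thesis by simp
    qed
    then have "?e \<star> (y \<star> y') = - (y \<star> y')"
      using tau_fixed_commutes(1)[OF trace0_products[OF y(2,4)]] by simp
    ultimately have "- (y' \<star> \<tau> y) + - (y \<star> y') = 0" by (simp only: bilinear_simps(5))
    then show ?thesis by (metis add_eq_0_iff minus_minus)
  qed
  have prod0: "y' \<star> t = 0" if t: "U t" "trace0 t" "U y'" "trace0 y'" for y' t
  proof -
    \<comment> \<open>Chosen so that \<open>\<tau> y - y\<close> is
      \<open>t + t - \<tau> t - \<tau> (\<tau> t)\<close>, which is three times \<open>t\<close> on
      N.\<close>
    define y where "y = \<tau> (\<tau> t) - t"
    have Utt: "U (\<tau> (\<tau> t))" using t by (simp add: tau_U U_nxt)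
    have y: "U y" "trace0 y" unfolding y_def
      by (rule U_linear(2)[OF Utt t(1)], rule trace0_linear(2)[OF trace0_tau[OF trace0_tau[OF t(2)]] t(2)])
    have "\<tau> y - y = t + t + t"
      using trace0_tau2[OF t(2)] by (simp add: y_def tau_linear tau_cube)
    moreover have "y' \<star> (\<tau> y - y) = 0"
      using twist[OF y t(3,4)] anti[OF y t(3,4)] by (simp add: bilinear_simps)
    ultimately have "y' \<star> t + y' \<star> t + y' \<star> t = 0" by (simp add: bilinear_simps)
    then show ?thesis by (rule triple_zero)
  qed
  have prodU: "y \<star> u = 0" if y: "U y" "trace0 y" and u: "U u" for y u
  proof -
    \<comment> \<open>The product lies in the trace-zero part of \<open>swap.U\<close>, and
      associativity of the form makes it orthogonal to the trace-zero part of \<open>U\<close>, so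
      it vanishes by duality.\<close>
    have "y \<star> proj1 u = 0"
    proof (rule ccontr)
      assume "y \<star> proj1 u \<noteq> 0"
      moreover have "trace0 (y \<star> proj1 u)" using tau_fixed_mult_trace0(2) proj1_fixed y by blast
      ultimately obtain y' where y': "U y'" "trace0 y'" "b y' (y \<star> proj1 u) \<noteq> 0"
        using trace0_swap_U_nondegenerate U_mult y U_proj u by blast
      then show False using prod0[OF y y'(1,2)] by (simp add: polar_assoc[symmetric] polar_simps)
    qed
    moreover have "y \<star> proj0 u = 0" using prod0 U_proj u proj0_trace0 y by blast
    ultimately have "y \<star> (3 \<cdot> u) = 0" unfolding proj_add[symmetric] by (simp add: bilinear_simps)
    then show ?thesis using three by (simp add: bilinear_simps)
  qed
  obtain y where y: "U y" "trace0 y" "y \<noteq> 0" using trace0_U_exists .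
  obtain v where v: "swap.U v" "b v y \<noteq> 0" using trace0_U_nondegenerate y by blast
  define y0 where "y0 = e2 \<star> y"
  \<comment> \<open>As \<open>y \<star> u = 0\<close>, flexibility recovers a multiple of
    \<open>u\<close> from \<open>(v \<star> u) \<star> y\<close>, and \<open>v \<star> u\<close> is
    a multiple of \<open>e2\<close>.\<close>
  have line: "\<exists>c. u = c \<cdot> y0" if u: "U u" for u
  proof -
    let ?v = "swap.nxt (swap.nxt v)"
    have "v = - (?v \<star> e2)" using swap.nxt_cube[OF v(1)] by (simp add: swap.nxt_def)
    then have vu: "v \<star> u = - (b ?v u \<cdot> e2)"
      using flexible_left_polar[of ?v e2 u] U_D[OF u]
      by (metis add.right_neutral bilinear_simps(6,8))
    have "(v \<star> u) \<star> y = b v y \<cdot> u"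
      using flexible_left_polar[of v u y] prodU[OF y(1,2) u] by (simp add: bilinear_simps)
    then have "b v y \<cdot> u = (- b ?v u) \<cdot> y0" by (simp add: vu bilinear_simps y0_def)
    then have "(1 / b v y) \<cdot> (b v y \<cdot> u) = (1 / b v y * - b ?v u) \<cdot> y0" by (simp add: algebra_simps)
    then have "u = (1 / b v y * - b ?v u) \<cdot> y0" using v(2) by simp
    then show ?thesis by blast
  qed
  obtain c where "y = c \<cdot> y0" using line y by blast
  then have vy0: "b v y0 \<noteq> 0" using v by (auto simp: polar_simps)
  \<comment> \<open>\<open>swap.U\<close> is dual to the line \<open>U\<close>: after the
    \<open>v\<close> component is removed, the rest is orthogonal to everything.\<close>
  have line': "\<exists>c. w = c \<cdot> v" if w: "swap.U w" for w
  proof -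
    define d where "d = w - (b w y0 / b v y0) \<cdot> v"
    have d: "swap.U d" unfolding d_def using w v swap.U_linear by blast
    have dy: "b d y0 = 0" using vy0 by (simp add: d_def polar_simps)
    have "b d z = 0" for z
    proof -
      obtain c where "proj_U z = c \<cdot> y0" using line proj_U by blast
      then show ?thesis using polar_swap_U[OF d, of z] dy by (simp add: polar_simps)
    qed
    then have "d = 0" by (rule nondegenerate)
    then show ?thesis by (auto simp: d_def)
  qed
  have "z \<in> span {e1, e2, y0, v}" for z
  proof -
    obtain c c' where "proj_U z = c \<cdot> y0" "swap.proj_U z = c' \<cdot> v" using line line' proj_U swap.proj_U by meson
    then have "z = b e2 z \<cdot> e1 + b e1 z \<cdot> e2 + c \<cdot> y0 + c' \<cdot> v" using decompose[of z] by simp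
    moreover have "\<dots> \<in> span {e1, e2, y0, v}"
      by (intro span_add span_scale span_base) auto
    ultimately show ?thesis by simp
  qed
  then have "dim UNIV \<le> card {e1, e2, y0, v}" by (intro dim_le_card) auto
  also have "\<dots> \<le> 4" by (rule card_insert_le_m1, simp)+ simp
  finally show False by (simp add: dim_8)
qed

text \<open>For fixed \<open>x\<close> and trace-zero \<open>y\<close> in \<open>U\<close>, the
  cubic form at \<open>x + y\<close> reduces to \<open>3 * b x (y \<star> y)\<close>, since
  \<open>x \<star> x = 0\<close> and \<open>y \<star> y\<close> in Q is orthogonal to
  \<open>y\<close>.\<close>

lemma generator_exists:
  obtains u where "U u" "b u (u \<star> u) = 1"
proof -
  obtain y where y: "U y" "trace0 y" "y \<star> y \<noteq> 0" using trace0_U_square_exists .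
  have p: "\<tau> (y \<star> y) = y \<star> y" using trace0_products y by blast
  obtain q where q: "\<tau> q = q" "b (y \<star> y) q \<noteq> 0" using fixed_nondegenerate p y by blast
  define x0 where "x0 = proj_U q"
  have "\<tau> x0 = x0" by (simp add: x0_def proj_U_def tau_linear tau_mult tau_e1 tau_e2 q)
  have bx0: "b x0 (y \<star> y) \<noteq> 0" using q polar_swap_U[OF U_square[OF y(1)]] polar_sym by (metis x0_def)
  \<comment> \<open>The factor 3 counts the three equal mixed terms of the cubic form.\<close>
  define x where "x = (1 / (3 * b x0 (y \<star> y))) \<cdot> x0"
  have x: "U x" "\<tau> x = x" unfolding x_def using \<open>\<tau> x0 = x0\<close>
    by (simp_all add: x0_def proj_U U_linear tau_linear)
  have k: "3 * b x (y \<star> y) = 1" using bx0 three by (simp add: x_def polar_simps)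
  \<comment> \<open>A fixed \<open>x\<close> in \<open>U\<close> equals
    \<open>- (e2 \<star> x)\<close>, so its square is a multiple of \<open>n x\<close>, which is
    zero.\<close>
  have "nxt (nxt x) = x" using x tau_U by simp
  then have "x \<star> x = - (x \<star> (e2 \<star> x))" using nxt_nxt[OF x(1)] by (metis bilinear_simps(5))
  then have xx: "x \<star> x = 0" by (simp add: flexible_right U_D x)
  have "b x (x \<star> y) = 0" by (simp add: polar_assoc[symmetric] xx polar_simps)
  moreover have "b x (y \<star> x) = 0" by (simp add: polar_sym[of x] polar_assoc xx polar_simps)
  moreover have "b y (x \<star> y) = b x (y \<star> y)" by (simp add: polar_sym[of y] polar_assoc)
  moreover have "b y (y \<star> x) = b x (y \<star> y)" by (metis polar_assoc polar_sym)
  moreover have "b y (y \<star> y) = 0" using tau_fixed_orth[OF p y(2)] polar_sym by metis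
  ultimately have "b (x + y) ((x + y) \<star> (x + y)) = 1"
    using k by (simp add: bilinear_simps polar_simps xx)
  then show ?thesis using that U_linear(1)[OF x(1) y(1)] by blast
qed

end

section \<open>Isomorphism with the split Okubo algebra\<close>

lemma algebra_isomorphism_inv:
  assumes f: "algebra_isomorphism A B f"
  shows "algebra_isomorphism B A (inv f)"
proof -
  have lin: "Vector_Spaces.linear (ascale A) (ascale B) f" and bij: "bij f"
    and m: "f (amult A x y) = amult B (f x) (f y)" and n: "anorm B (f x) = anorm A x" for x y
    using f by (auto simp: algebra_isomorphism_def)
  interpret f: Vector_Spaces.linear "ascale A" "ascale B" f by (rule lin)
  have fi: "f (inv f y) = y" for y using bij by (simp add: bij_is_surj surj_f_inv_f)
  have eqI: "f x = y \<Longrightarrow> inv f y = x" for x y using bij by (auto simp: bij_is_inj)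
  have "Vector_Spaces.linear (ascale B) (ascale A) (inv f)"
    unfolding Vector_Spaces.linear_iff
    by (auto intro!: f.vs1.vector_space_axioms f.vs2.vector_space_axioms eqI simp: f.add f.scale fi)
  moreover have "inv f (amult B x y) = amult A (inv f x) (inv f y)" for x y
    by (rule eqI) (simp add: m fi)
  moreover have "anorm A (inv f x) = anorm B x" for x using n[of "inv f x"] by (simp add: fi)
  ultimately show ?thesis using bij bij_imp_bij_inv by (auto simp: algebra_isomorphism_def)
qed

lemma card_cayley_index: "CARD(cayley_index) = 8"
proof -
  have "card (range Iu) = 3" "card (range Iv) = 3" by (simp_all add: card_image inj_def)
  moreover have "range Iu \<inter> range Iv = {}" "{Ie1, Ie2} \<inter> (range Iu \<union> range Iv) = {}" by auto
  ultimately show ?thesis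
    unfolding UNIV_cayley_index Un_assoc by (simp only: card_Un_disjoint finite_imageI finite finite_Un) simp
qed

context okubo_frame
begin

text \<open>The injective homomorphism \<open>lin u\<close> runs between spaces of dimension 8, so
  it is bijective, and its inverse is the isomorphism.\<close>

lemma isomorphic_split_okubo: "isomorphic_algebras A (split_okubo :: ('f, 'f ^ cayley_index) normed_algebra)"
proof -
  obtain u where u: "U u" "b u (u \<star> u) = 1" using generator_exists .
  have lin: "Vector_Spaces.linear (*s) scl (lin u)"
    by (rule cart_linearI) (use u lin_linear vector_space_axioms in auto)
  interpret l: Vector_Spaces.linear "(*s)" scl "lin u" by (rule lin)
  have inj: "inj (lin u)" using lin_inj u by blast
  obtain B where B: "independent B" "span B = UNIV"
    using basis_exists[of UNIV] by (metis top.extremum_uniqueI)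
  have cB: "card B = 8" using dim_eq_card[of B UNIV] B dim_8 by simp
  then have fB: "finite B" by (metis card.infinite zero_neq_numeral)
  interpret fd: finite_dimensional_vector_space scl B
    by unfold_locales (use B fB in auto)
  interpret p: finite_dimensional_vector_space_pair "(*s)" "cart_basis :: ('f ^ cayley_index) set" scl B ..
  have sub: "subspace (range (lin u))" by (rule l.subspace_image) simp
  have "dim (range (lin u)) = vec.dim (UNIV :: ('f ^ cayley_index) set)"
    by (rule p.dim_image_eq[OF lin]) (use inj in auto)
  then have surj: "range (lin u) = UNIV"
    using fd.subspace_dim_equal[OF sub, of UNIV] dim_8 by (simp add: vec.dim_UNIV card_cart_basis card_cayley_index)
  have "algebra_isomorphism split_okubo A (lin u)"
    unfolding algebra_isomorphism_def split_okubo_sel(1)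
    using lin inj surj u lin_mult lin_norm by (simp add: bij_def)
  then show ?thesis using algebra_isomorphism_inv unfolding isomorphic_algebras_def by blast
qed

end

lemma isotropic_idempotent_transport:
  assumes "isomorphic_algebras A B" "isotropic (anorm B)" "is_idempotent B e"
  shows "isotropic (anorm A)" "\<exists>e. is_idempotent A e"
proof -
  obtain g where g: "algebra_isomorphism B A g"
    using assms(1) algebra_isomorphism_inv by (auto simp: isomorphic_algebras_def)
  interpret g: Vector_Spaces.linear "ascale B" "ascale A" g using g by (simp add: algebra_isomorphism_def)
  have nz: "g x \<noteq> 0" if "x \<noteq> 0" for x
    using g that g.zero by (metis algebra_isomorphism_def bij_pointE)
  show "isotropic (anorm A)"
    using assms(2) nz g unfolding isotropic_def algebra_isomorphism_def by metis
  show "\<exists>e. is_idempotent A e"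
    using assms(3) nz g unfolding is_idempotent_def algebra_isomorphism_def by metis
qed

subsection \<open>Transfer from the split Okubo algebra\<close>

text \<open>With all sums expanded, the identities below become polynomial identities in the
  coordinates.\<close>

lemma split_okubo_mult_nth:
  fixes x y :: "'f::field ^ cayley_index"
  shows
  "amult split_okubo x y $ Ie1 = x $ Ie2 * y $ Ie2 - (x $ Iu 3 * y $ Iv 2 + x $ Iu 1 * y $ Iv 3 + x $ Iu 2 * y $ Iv 1)"
  "amult split_okubo x y $ Ie2 = x $ Ie1 * y $ Ie1 - (x $ Iv 3 * y $ Iu 2 + x $ Iv 1 * y $ Iu 3 + x $ Iv 2 * y $ Iu 1)"
  "amult split_okubo x y $ Iu 1 = - x $ Ie2 * y $ Iu 2 - x $ Iu 3 * y $ Ie1 + x $ Iv 1 * y $ Iv 1 - x $ Iv 2 * y $ Iv 3"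
  "amult split_okubo x y $ Iu 2 = - x $ Ie2 * y $ Iu 3 - x $ Iu 1 * y $ Ie1 + x $ Iv 2 * y $ Iv 2 - x $ Iv 3 * y $ Iv 1"
  "amult split_okubo x y $ Iu 3 = - x $ Ie2 * y $ Iu 1 - x $ Iu 2 * y $ Ie1 + x $ Iv 3 * y $ Iv 3 - x $ Iv 1 * y $ Iv 2"
  "amult split_okubo x y $ Iv 1 = - x $ Ie1 * y $ Iv 2 - x $ Iv 3 * y $ Ie2 + x $ Iu 1 * y $ Iu 1 - x $ Iu 2 * y $ Iu 3"
  "amult split_okubo x y $ Iv 2 = - x $ Ie1 * y $ Iv 3 - x $ Iv 1 * y $ Ie2 + x $ Iu 2 * y $ Iu 2 - x $ Iu 3 * y $ Iu 1"
  "amult split_okubo x y $ Iv 3 = - x $ Ie1 * y $ Iv 1 - x $ Iv 2 * y $ Ie2 + x $ Iu 3 * y $ Iu 3 - x $ Iu 1 * y $ Iu 2"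
  by (simp_all add: split_okubo_mult cayley_mult_nth tau_st_nth conjugation_nth sum_3 three_simps)

lemma split_okubo_norm: "anorm split_okubo x = x $ Ie1 * x $ Ie2 + x $ Iu 1 * x $ Iv 1 + x $ Iu 2 * x $ Iv 2 + x $ Iu 3 * x $ Iv 3"
  by (simp add: split_okubo_sel anorm_cayley sum_3)

lemma split_okubo_polar: "polar (anorm split_okubo) x y = x $ Ie1 * y $ Ie2 + x $ Ie2 * y $ Ie1
   + x $ Iu 1 * y $ Iv 1 + x $ Iv 1 * y $ Iu 1 + x $ Iu 2 * y $ Iv 2 + x $ Iv 2 * y $ Iu 2 + x $ Iu 3 * y $ Iv 3 + x $ Iv 3 * y $ Iu 3"
  by (simp add: polar_def split_okubo_norm algebra_simps)

lemma split_okubo_norm_mult: "anorm split_okubo (amult split_okubo x y) = anorm split_okubo x * anorm split_okubo y"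
  by (simp add: split_okubo_norm split_okubo_mult_nth algebra_simps)

lemma split_okubo_polar_assoc: "polar (anorm split_okubo) (amult split_okubo x y) z = polar (anorm split_okubo) x (amult split_okubo y z)"
  by (simp add: split_okubo_polar split_okubo_mult_nth algebra_simps)

lemma split_okubo_flexible:
   "amult split_okubo (amult split_okubo x y) x = anorm split_okubo x *s y"
   "amult split_okubo x (amult split_okubo y x) = anorm split_okubo x *s y"
  by (simp_all add: split_okubo_norm cayley_vec_eq_iff forall_3 split_okubo_mult_nth algebra_simps)

lemma split_okubo_cyclic:
  "amult split_okubo (amult split_okubo x y) z + amult split_okubo (amult split_okubo y z) x + amult split_okubo (amult split_okubo z x) y
      = amult split_okubo x (amult split_okubo y z) + amult split_okubo y (amult split_okubo z x) + amult split_okubo z (amult split_okubo x y)"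
  by (simp add: cayley_vec_eq_iff forall_3 split_okubo_mult_nth algebra_simps)

lemma split_okubo_nondegenerate:
  assumes "\<And>y. polar (anorm split_okubo) x y = 0" shows "x = 0"
proof -
  have "polar (anorm split_okubo) x (cayley_basis i) = 0" for i by (rule assms)
  from this[of Ie1] this[of Ie2] this[of "Iu 1"] this[of "Iu 2"] this[of "Iu 3"] this[of "Iv 1"] this[of "Iv 2"] this[of "Iv 3"]
  show ?thesis by (simp add: split_okubo_polar cayley_vec_eq_iff forall_3 axis_def)
qed

lemma split_okubo_center:
  assumes "\<And>y. amult split_okubo x y = amult split_okubo y x" shows "x = 0"
proof -
  have "amult split_okubo x (cayley_basis i) = amult split_okubo (cayley_basis i) x" for i by (rule assms)
  from this[of Ie1] this[of Ie2] this[of "Iu 1"] this[of "Iu 2"] this[of "Iu 3"] this[of "Iv 1"] this[of "Iv 2"] this[of "Iv 3"]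
  show ?thesis by (simp add: split_okubo_mult_nth cayley_vec_eq_iff forall_3 axis_def)
qed

text \<open>\<phi> is the embedding into the scalar extension followed by the isomorphism. It is
  linear only along \<open>h\<close>, but it is injective and its range spans.\<close>

lemma okubo_algebra_embedding:
  fixes A :: "('f::field, 'v::ab_group_add) normed_algebra"
  assumes "okubo_algebra TYPE('k::field) TYPE('w::ab_group_add) A"
  obtains h :: "'f \<Rightarrow> 'k::field" and \<phi> :: "'v \<Rightarrow> 'k::field ^ cayley_index"
  where "field_embedding h" "\<And>x y. \<phi> (x + y) = \<phi> x + \<phi> y" "\<And>c x. \<phi> (ascale A c x) = h c *s \<phi> x"
    "\<And>x y. \<phi> (amult A x y) = amult split_okubo (\<phi> x) (\<phi> y)"
    "\<And>x. anorm split_okubo (\<phi> x) = h (anorm A x)"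
    "inj \<phi>" "vec.span (range \<phi>) = UNIV" "vector_space.dim (ascale A) UNIV = 8"
proof -
  have A: "is_normed_algebra A" using assms by (simp add: okubo_algebra_def)
  obtain h :: "'f \<Rightarrow> 'k" and W :: "('k, 'w) normed_algebra" and \<iota> f
    where h: "field_embedding h" and W: "is_scalar_extension h A W \<iota>"
      and f: "algebra_isomorphism W split_okubo f"
    using assms by (auto simp: okubo_algebra_def isomorphic_algebras_def)
  interpret VA: vector_space "ascale A" using A by (simp add: is_normed_algebra_def)
  have lin: "Vector_Spaces.linear (ascale W) (*s) f" and bij: "bij f"
    using f by (simp_all add: algebra_isomorphism_def split_okubo_sel)
  interpret f: Vector_Spaces.linear "ascale W" "(*s)" f by (rule lin)
  have \<iota>: "\<iota> (x + y) = \<iota> x + \<iota> y" "\<iota> (ascale A c x) = ascale W (h c) (\<iota> x)"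
    "\<iota> (amult A x y) = amult W (\<iota> x) (\<iota> y)" "anorm W (\<iota> x) = h (anorm A x)" for x y c
    using W by (auto simp: is_scalar_extension_def)
  have basis: "inj_on \<iota> B" "f.vs1.independent (\<iota> ` B)" "f.vs1.span (\<iota> ` B) = UNIV"
    if "VA.independent B" "VA.span B = UNIV" for B
    using W that by (auto simp: is_scalar_extension_def)
  have span_image: "vec.span (f ` \<iota> ` B) = UNIV" if "VA.independent B" "VA.span B = UNIV" for B
    using f.span_image[of "\<iota> ` B"] basis(3)[OF that] bij by (simp add: bij_is_surj)
  obtain B where B: "VA.independent B" "VA.span B = UNIV"
    using VA.basis_exists[of UNIV] by (metis top.extremum_uniqueI)
  have ind: "vec.independent (f ` \<iota> ` B)"
    using f.independent_injective_image[OF basis(2)[OF B]] bij by (meson bij_is_inj inj_on_subset subset_UNIV)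
  have "card (f ` \<iota> ` B) = 8"
    using vec.dim_eq_card[of "f ` \<iota> ` B" UNIV] span_image[OF B] ind
    by (simp add: vec.dim_UNIV card_cart_basis card_cayley_index)
  moreover have "inj_on (f \<circ> \<iota>) B"
    using basis(1)[OF B] bij by (meson bij_is_inj comp_inj_on inj_on_subset subset_UNIV)
  ultimately have "card B = 8" by (metis card_image image_comp)
  then have dim: "VA.dim UNIV = 8" using VA.dim_eq_card[of B UNIV] B by simp
  have nz: "\<iota> x \<noteq> 0" if "x \<noteq> 0" for x
  proof -
    \<comment> \<open>A nonzero vector extends to a basis, whose image under \<iota> is
      independent.\<close>
    have "VA.independent {x}" using that by simp
    then obtain C where C: "{x} \<subseteq> C" "VA.independent C" "VA.span C = UNIV"
      by (metis VA.independent_extend_basis VA.extend_basis_superset VA.span_extend_basis)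
    then show ?thesis using basis(2)[OF C(2,3)] f.vs1.dependent_zero by (metis image_eqI insert_subset)
  qed
  have "\<iota> x \<noteq> \<iota> y" if "x \<noteq> y" for x y
    using nz[of "x - y"] \<iota>(1)[of "x - y" y] that by auto
  then have "inj \<iota>" by (auto simp: inj_def)
  then have inj: "inj (f \<circ> \<iota>)" using bij by (auto intro: inj_compose simp: bij_is_inj)
  have "vec.span (f ` \<iota> ` B) \<subseteq> vec.span (range (f \<circ> \<iota>))" by (intro vec.span_mono) auto
  then have sp: "vec.span (range (f \<circ> \<iota>)) = UNIV" using span_image[OF B] by auto
  show ?thesis
    by (rule that[of h "f \<circ> \<iota>", OF h _ _ _ _ inj sp dim])
      (use f in \<open>auto simp: \<iota> f.add f.scale algebra_isomorphism_def\<close>)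
qed

text \<open>Identities descend through the injective \<phi>. For nondegeneracy and the center, a
  condition on \<open>A\<close> extends to the whole split algebra because the range of \<phi>
  spans.\<close>

lemma okubo_algebra_composition:
  fixes A :: "('f::field, 'v::ab_group_add) normed_algebra"
  assumes A: "okubo_algebra TYPE('k::field) TYPE('w::ab_group_add) A" and char: "CHAR('f) \<noteq> 3"
  shows "okubo_composition A"
proof -
  obtain h :: "'f \<Rightarrow> 'k" and \<phi> :: "'v \<Rightarrow> 'k ^ cayley_index" where h: "field_embedding h"
    and \<phi>: "\<And>x y. \<phi> (x + y) = \<phi> x + \<phi> y" "\<And>c x. \<phi> (ascale A c x) = h c *s \<phi> x"
    "\<And>x y. \<phi> (amult A x y) = amult split_okubo (\<phi> x) (\<phi> y)"
    "\<And>x. anorm split_okubo (\<phi> x) = h (anorm A x)"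
    and inj: "inj \<phi>" and sp: "vec.span (range \<phi>) = UNIV"
    and dim: "vector_space.dim (ascale A) UNIV = 8"
    using okubo_algebra_embedding[OF A] by blast
  have h_simps: "h (x + y) = h x + h y" "h (x * y) = h x * h y" "h 1 = 1" for x y
    using h by (auto simp: field_embedding_def)
  have h0: "h 0 = 0" using h_simps(1)[of 0 0] by (metis add_0 add_cancel_right_right)
  have hd: "h (x - y) = h x - h y" for x y using h_simps(1)[of "x - y" y] by simp
  have h_eq: "h x = h y \<Longrightarrow> x = y" for x y
  proof (rule ccontr)
    assume "h x = h y" "x \<noteq> y"
    then have "h ((x - y) * inverse (x - y)) = 0" by (simp only: h_simps(2) hd) simp
    then show False using \<open>x \<noteq> y\<close> h_simps(3) by simp
  qed
  have \<phi>_eq: "\<phi> x = \<phi> y \<Longrightarrow> x = y" for x y using inj by (simp add: inj_def)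
  have \<phi>0: "\<phi> 0 = 0" using \<phi>(1)[of 0 0] by simp
  have pol: "polar (anorm split_okubo) (\<phi> x) (\<phi> y) = h (polar (anorm A) x y)" for x y
    by (simp add: polar_def hd \<phi>(4) flip: \<phi>(1))
  show ?thesis
  proof
    show "is_normed_algebra A" using A by (simp add: okubo_algebra_def)
    show "anorm A (amult A x y) = anorm A x * anorm A y" for x y
      by (rule h_eq) (simp add: h_simps \<phi>(3) split_okubo_norm_mult flip: \<phi>(4))
    show "polar (anorm A) (amult A x y) z = polar (anorm A) x (amult A y z)" for x y z
      by (rule h_eq) (simp add: \<phi>(3) split_okubo_polar_assoc flip: pol)
    show "amult A (amult A x y) x = ascale A (anorm A x) y" for x y
      by (rule \<phi>_eq) (simp add: \<phi> split_okubo_flexible)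
    show "amult A x (amult A y x) = ascale A (anorm A x) y" for x y
      by (rule \<phi>_eq) (simp add: \<phi> split_okubo_flexible)
    show "amult A (amult A x y) z + amult A (amult A y z) x + amult A (amult A z x) y
      = amult A x (amult A y z) + amult A y (amult A z x) + amult A z (amult A x y)" for x y z
      by (rule \<phi>_eq) (simp only: \<phi> split_okubo_cyclic)
    show "(3::'f) \<noteq> 0"
    proof
      assume "(3::'f) = 0"
      then have "of_nat 3 = (0::'f)" by simp
      then have "CHAR('f) dvd 3" by (simp only: of_nat_eq_0_iff_char_dvd)
      then have "CHAR('f) = 1" using char prime_nat_iff[of 3] by auto
      then show False by simp
    qed
    show "x = 0" if "\<And>y. polar (anorm A) x y = 0" for x
    proof -
      have "Vector_Spaces.linear (*s) (*) (polar (anorm split_okubo) (\<phi> x))"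
        using split_okubo_is_normed_algebra
        by (metis is_normed_algebra_def quadratic_form_def split_okubo_sel(1))
      then interpret l: Vector_Spaces.linear "(*s)" "(*)" "polar (anorm split_okubo) (\<phi> x)" .
      have "polar (anorm split_okubo) (\<phi> x) z = 0" for z
        by (rule span_UNIV_induct[OF vec.vector_space_axioms sp])
          (auto simp: l.zero l.add l.scale pol that h0)
      then have "\<phi> x = \<phi> 0" unfolding \<phi>0 by (rule split_okubo_nondegenerate)
      then show ?thesis by (rule \<phi>_eq)
    qed
    show "x = 0" if "\<And>y. amult A x y = amult A y x" for x
    proof -
      have "Vector_Spaces.linear (*s) (*s) (amult split_okubo (\<phi> x))"
        "Vector_Spaces.linear (*s) (*s) (\<lambda>y. amult split_okubo y (\<phi> x))"
        using split_okubo_is_normed_algebra by (metis is_normed_algebra_def split_okubo_sel(1))+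
      then interpret l: Vector_Spaces.linear "(*s)" "(*s)" "amult split_okubo (\<phi> x)"
        + r: Vector_Spaces.linear "(*s)" "(*s)" "\<lambda>y. amult split_okubo y (\<phi> x)" .
      have "amult split_okubo (\<phi> x) z = amult split_okubo z (\<phi> x)" for z
        by (rule span_UNIV_induct[OF vec.vector_space_axioms sp])
          (auto simp: l.zero l.add l.scale r.zero r.add r.scale that simp flip: \<phi>(3))
      then have "\<phi> x = \<phi> 0" unfolding \<phi>0 by (rule split_okubo_center)
      then show ?thesis by (rule \<phi>_eq)
    qed
    show "vector_space.dim (ascale A) UNIV = 8" by (rule dim)
  qed
qed

theorem theorem5p9:
  fixes A :: "('f::field, 'v::ab_group_add) normed_algebra"
  assumes "okubo_algebra TYPE('k::field) TYPE('w::ab_group_add) A"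
    and "CHAR('f) \<noteq> 3"
  shows "isomorphic_algebras A (split_okubo :: ('f, 'f ^ cayley_index) normed_algebra) \<longleftrightarrow>
    isotropic (anorm A) \<and> (\<exists>e. is_idempotent A e)"
proof
  assume "isomorphic_algebras A (split_okubo :: ('f, 'f ^ cayley_index) normed_algebra)"
  then show "isotropic (anorm A) \<and> (\<exists>e. is_idempotent A e)"
    using isotropic_idempotent_transport split_okubo_isotropic_idempotent by blast
next
  assume "isotropic (anorm A) \<and> (\<exists>e. is_idempotent A e)"
  then obtain e where iso: "isotropic (anorm A)" and e: "is_idempotent A e" by blast
  interpret okubo_composition A using assms by (rule okubo_algebra_composition)
  interpret i: idempotent_okubo A e
    by unfold_locales (use e in \<open>auto simp: is_idempotent_def\<close>)
  obtain x where x: "n x = 0" "b x (x \<star> x) = 1" using i.cube_one_if_isotropic[OF iso] by blast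
  interpret okubo_frame A x "x \<star> x"
    by unfold_locales (use x in \<open>simp_all add: norm_mult square_of_square\<close>)
  show "isomorphic_algebras A (split_okubo :: ('f, 'f ^ cayley_index) normed_algebra)"
    by (rule isomorphic_split_okubo)
qed

end
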